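(* Let $p$ be a pseudo existentially closed (PEC) finite partial automorphism of $\mathbf T$, and let $A$ be the meet-tree generated by the union of all orbits of $p$. Let $\xi=(\xi_0,\xi_1,\ldots,\xi_n)$ be an orbit of $p$ such that no non-cyclic orbit of $p$ has smaller length. Then if $p\cup \{(\xi_n, v)\}$ and $p\cup \{(\xi_n,w)\}$ are both extensions of $p$ to a partial automorphism of $\mathbf T$, then $\operatorname{tp}(v/A)=\operatorname{tp}(w/A)$.
   Context: A meet-tree is a partial order $(T,\leq)$ in which, for every $a$, the set $\{x: x\leq a\}$ is linearly ordered, every two elements have a common lower bound, equipped with the meet function $\mathbin{\wedge}$ giving the greatest common lower bound. $\mathbf T$ denotes the universal countable dense meet-tree, i.e.\ the Fraïssé limit of the class of finite meet-trees (language $\{\leq,\mathbin{\wedge}\}$); it is ultrahomogeneous and has quantifier elimination. A partial automorphism is a partial map preserving quantifier-free types; $\operatorname{dom}(p)$ and $\operatorname{range}(p)$ denote its domain and range, and $\operatorname{tp}$ denotes the (complete) type in $\mathbf T$. A (finite) partial orbit is a sequence $(\eta_0,\ldots,\eta_n)$ such that $\eta_i\mapsto\eta_{i+1}$ ($i<n$) is a partial automorphism. An orbit of a finite partial automorphism $p$ is a partial orbit $\eta=(\eta_0,\ldots,\eta_n)$ with $p(\eta_i)=\eta_{i+1}$ for $i<n$ and either $\eta_0=\eta_k$ for some $k\leq n$ (a cyclic orbit) or $\eta_0\notin\operatorname{range}(p)$ and $\eta_n\notin\operatorname{dom}(p)$. The length of $\eta$ is the size of $\{\eta_0,\ldots,\eta_n\}$.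 An initial point of $p$ is an $a\in\operatorname{dom}(p)$ with $a\notin\operatorname{range}(p)$ or $a$ in a cyclic orbit of $p$. For an orbit $\mu$ with initial point $\mu_0$ we write $\mu_m=p^m(\mu_0)$, and $\mu_m{\downarrow}$ / $\mu_m{\uparrow}$ for "defined"/"undefined". $p$ is PEC if: for every extension $q\supseteq p$ to a partial automorphism of $\mathbf T$, every triple $\eta_0,\mu_0,\zeta_0$ of initial points of $p$ (in orbits $\eta,\mu,\zeta$ of $p$) and every $m_1,m_2>0$ with $q^{m_1}(\mu_0),q^{m_2}(\zeta_0)$ defined, there are positive integers $m_1',m_2',m_1'',m_2''$ such that: (a) if $\mu_{m_1}{\uparrow}$ then $m_1'\neq m_1''$; (b) the triples $(\eta_0,q^{m_1}(\mu_0),q^{m_2}(\zeta_0))$, $(\eta_0,\mu_{m_1'},\zeta_{m_2'})$, $(\eta_0,\mu_{m_1''},\zeta_{m_2''})$ are defined and have the same quantifier-free type in $\mathbf T$; (c) if there is $k$ with $\mu_0\mathbin{\wedge} q^k(\mu_0)\neq q^k(\mu_0)\mathbin{\wedge} q^{2k}(\mu_0)$, then for the minimal such $k$, $m_1\equiv m_1'\equiv m_1''\pmod k$. *)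

theory Defs
  imports HOL.Hull "HOL-Library.Countable_Set" "HOL-Number_Theory.Cong"
begin

section \<open>Meet-trees and the universal countable dense meet-tree\<close>

definition meet_tree_on :: "'a set \<Rightarrow> ('a \<Rightarrow> 'a \<Rightarrow> bool) \<Rightarrow> ('a \<Rightarrow> 'a \<Rightarrow> 'a) \<Rightarrow> bool" where
  "meet_tree_on V le mt \<longleftrightarrow>
     reflp_on V le \<and> antisymp_on V le \<and> transp_on V le \<and>
     (\<forall>a\<in>V. totalp_on {x \<in> V. le x a} le) \<and>
     (\<forall>x\<in>V. \<forall>y\<in>V. mt x y \<in> V \<and> le (mt x y) x \<and> le (mt x y) y \<and>
        (\<forall>z\<in>V. le z x \<longrightarrow> le z y \<longrightarrow> le z (mt x y)))"

definition embedding_on ::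
  "'b set \<Rightarrow> ('b \<Rightarrow> 'b \<Rightarrow> bool) \<Rightarrow> ('b \<Rightarrow> 'b \<Rightarrow> 'b) \<Rightarrow> ('b \<Rightarrow> 'a::semilattice_inf) \<Rightarrow> bool" where
  "embedding_on V le mt f \<longleftrightarrow> inj_on f V \<and>
     (\<forall>x\<in>V. \<forall>y\<in>V. (le x y \<longleftrightarrow> f x \<le> f y) \<and> f (mt x y) = inf (f x) (f y))"

abbreviation meet_closed :: "'a::semilattice_inf set \<Rightarrow> bool" where
  "meet_closed A \<equiv> \<forall>x\<in>A. \<forall>y\<in>A. inf x y \<in> A"

text \<open>
  The type as a whole, with its order and \<^term>\<open>inf\<close>, is the Fraisse limit of the class of
  finite meet-trees: a countable structure whose age is that class and which is
  ultrahomogeneous. Every finite meet-tree has an isomorphic copy on a finite set of natural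
  numbers, so the third conjunct says that all finite meet-trees embed. The other half of the
  condition on the age follows from the second conjunct. Finitely generated substructures of a
  meet-tree are precisely its finite meet-closed subsets.
\<close>

definition universal_meet_tree :: "'a::semilattice_inf itself \<Rightarrow> bool" where
  "universal_meet_tree _ \<longleftrightarrow>
     countable (UNIV :: 'a set) \<and>
     meet_tree_on (UNIV :: 'a set) (\<le>) inf \<and>
     (\<forall>(V :: nat set) le mt. finite V \<longrightarrow> meet_tree_on V le mt \<longrightarrow>
        (\<exists>f :: nat \<Rightarrow> 'a. embedding_on V le mt f)) \<and>
     (\<forall>(A :: 'a set) (f :: 'a \<Rightarrow> 'a).
        finite A \<longrightarrow> meet_closed A \<longrightarrow> embedding_on A (\<le>) inf f \<longrightarrow>
        (\<exists>g :: 'a \<Rightarrow> 'a. bij g \<and> embedding_on UNIV (\<le>) inf g \<and> (\<forall>x\<in>A. g x = f x)))"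

definition generated_meet_tree :: "'a::semilattice_inf set \<Rightarrow> 'a set" where
  "generated_meet_tree S = meet_closed hull S"


section \<open>First-order formulas and types\<close>

text \<open>Formulas in the language of order and meet, with elements of \<open>'a\<close> as parameters.\<close>

datatype (tm_params: 'a) tm =
    Var nat
  | Par 'a
  | Meet "'a tm" "'a tm"

datatype (fm_params: 'a) fm =
    Le "'a tm" "'a tm"
  | Eq "'a tm" "'a tm"
  | Neg "'a fm"
  | Conj "'a fm" "'a fm"
  | Ex nat "'a fm"

primrec tm_vars :: "'a tm \<Rightarrow> nat set" where
  "tm_vars (Var i) = {i}"
| "tm_vars (Par a) = {}"
| "tm_vars (Meet s t) = tm_vars s \<union> tm_vars t"

primrec free_vars :: "'a fm \<Rightarrow> nat set" where
  "free_vars (Le s t) = tm_vars s \<union> tm_vars t"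
| "free_vars (Eq s t) = tm_vars s \<union> tm_vars t"
| "free_vars (Neg \<phi>) = free_vars \<phi>"
| "free_vars (Conj \<phi> \<psi>) = free_vars \<phi> \<union> free_vars \<psi>"
| "free_vars (Ex i \<phi>) = free_vars \<phi> - {i}"

primrec qfree :: "'a fm \<Rightarrow> bool" where
  "qfree (Le s t) \<longleftrightarrow> True"
| "qfree (Eq s t) \<longleftrightarrow> True"
| "qfree (Neg \<phi>) \<longleftrightarrow> qfree \<phi>"
| "qfree (Conj \<phi> \<psi>) \<longleftrightarrow> qfree \<phi> \<and> qfree \<psi>"
| "qfree (Ex i \<phi>) \<longleftrightarrow> False"

primrec tm_val :: "(nat \<Rightarrow> 'a) \<Rightarrow> 'a::semilattice_inf tm \<Rightarrow> 'a" where
  "tm_val e (Var i) = e i"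
| "tm_val e (Par a) = a"
| "tm_val e (Meet s t) = inf (tm_val e s) (tm_val e t)"

primrec sat :: "(nat \<Rightarrow> 'a) \<Rightarrow> 'a::semilattice_inf fm \<Rightarrow> bool" where
  "sat e (Le s t) \<longleftrightarrow> tm_val e s \<le> tm_val e t"
| "sat e (Eq s t) \<longleftrightarrow> tm_val e s = tm_val e t"
| "sat e (Neg \<phi>) \<longleftrightarrow> \<not> sat e \<phi>"
| "sat e (Conj \<phi> \<psi>) \<longleftrightarrow> sat e \<phi> \<and> sat e \<psi>"
| "sat e (Ex i \<phi>) \<longleftrightarrow> (\<exists>x. sat (e(i := x)) \<phi>)"

text \<open>The variable \<^term>\<open>Var i\<close> stands for the \<open>i\<close>-th entry of the tuple (counting from 0).\<close>

definition tp :: "'a::semilattice_inf list \<Rightarrow> 'a set \<Rightarrow> 'a fm set" where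
  "tp xs A = {\<phi>. fm_params \<phi> \<subseteq> A \<and> free_vars \<phi> \<subseteq> {..<length xs} \<and> sat (\<lambda>i. xs ! i) \<phi>}"

definition qftp :: "'a::semilattice_inf list \<Rightarrow> 'a fm set" where
  "qftp xs = {\<phi> \<in> tp xs {}. qfree \<phi>}"


section \<open>Partial automorphisms and orbits\<close>

text \<open>
  Partial maps are represented by their graphs, so that \<open>b = q\<^sup>m(a)\<close>, with \<open>q\<^sup>m(a)\<close> defined,
  reads \<open>(a, b) \<in> q ^^ m\<close>.
\<close>

definition partial_automorphism :: "('a::semilattice_inf \<times> 'a) set \<Rightarrow> bool" where
  "partial_automorphism p \<longleftrightarrow> single_valued p \<and>
     (\<forall>ps. set ps \<subseteq> p \<longrightarrow> qftp (map fst ps) = qftp (map snd ps))"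

definition partial_orbit :: "'a::semilattice_inf list \<Rightarrow> bool" where
  "partial_orbit xs \<longleftrightarrow> xs \<noteq> [] \<and>
     partial_automorphism {(xs ! i, xs ! Suc i) | i. Suc i < length xs}"

definition cyclic :: "'a list \<Rightarrow> bool" where
  "cyclic xs \<longleftrightarrow> (\<exists>k. 0 < k \<and> k < length xs \<and> xs ! 0 = xs ! k)"

text \<open>
  The bound on the length excludes the degenerate sequences \<open>(a)\<close> with \<open>a\<close> outside both the
  domain and the range of \<open>p\<close>: an orbit of \<open>p\<close> consists of points of the domain and range.
\<close>

definition orbit_of :: "('a::semilattice_inf \<times> 'a) set \<Rightarrow> 'a list \<Rightarrow> bool" where
  "orbit_of p xs \<longleftrightarrow> partial_orbit xs \<and> 2 \<le> length xs \<and>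
     (\<forall>i. Suc i < length xs \<longrightarrow> (xs ! i, xs ! Suc i) \<in> p) \<and>
     (cyclic xs \<or> hd xs \<notin> Range p \<and> last xs \<notin> Domain p)"

definition orbit_length :: "'a list \<Rightarrow> nat" where
  "orbit_length xs = card (set xs)"

definition initial_point :: "('a::semilattice_inf \<times> 'a) set \<Rightarrow> 'a \<Rightarrow> bool" where
  "initial_point p a \<longleftrightarrow> a \<in> Domain p \<and>
     (a \<notin> Range p \<or> (\<exists>xs. orbit_of p xs \<and> cyclic xs \<and> a \<in> set xs))"


section \<open>Pseudo existentially closed partial automorphisms\<close>

definition meet_moved :: "('a::semilattice_inf \<times> 'a) set \<Rightarrow> 'a \<Rightarrow> nat \<Rightarrow> bool" where
  "meet_moved q a k \<longleftrightarrow>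
     (\<exists>b c. (a, b) \<in> q ^^ k \<and> (a, c) \<in> q ^^ (2 * k) \<and> inf a b \<noteq> inf b c)"

text \<open>
  Below, \<open>b\<close> and \<open>c\<close> are the iterates under \<open>q\<close> of the initial points \<open>\<mu>\<close> and \<open>\<zeta>\<close>; the primed
  ones are iterates under \<open>p\<close>.
\<close>

definition PEC :: "('a::semilattice_inf \<times> 'a) set \<Rightarrow> bool" where
  "PEC p \<longleftrightarrow>
     (\<forall>q \<eta> \<mu> \<zeta> m1 m2 b c.
        p \<subseteq> q \<longrightarrow> partial_automorphism q \<longrightarrow>
        initial_point p \<eta> \<longrightarrow> initial_point p \<mu> \<longrightarrow> initial_point p \<zeta> \<longrightarrow>
        0 < m1 \<longrightarrow> 0 < m2 \<longrightarrow> (\<mu>, b) \<in> q ^^ m1 \<longrightarrow> (\<zeta>, c) \<in> q ^^ m2 \<longrightarrow>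
        (\<exists>m1' m2' m1'' m2''.
           0 < m1' \<and> 0 < m2' \<and> 0 < m1'' \<and> 0 < m2'' \<and>
           (\<mu> \<notin> Domain (p ^^ m1) \<longrightarrow> m1' \<noteq> m1'') \<and>
           (\<exists>b' c' b'' c''.
              (\<mu>, b') \<in> p ^^ m1' \<and> (\<zeta>, c') \<in> p ^^ m2' \<and>
              (\<mu>, b'') \<in> p ^^ m1'' \<and> (\<zeta>, c'') \<in> p ^^ m2'' \<and>
              qftp [\<eta>, b, c] = qftp [\<eta>, b', c'] \<and>
              qftp [\<eta>, b, c] = qftp [\<eta>, b'', c'']) \<and>
           ((\<exists>k. meet_moved q \<mu> k) \<longrightarrow>
              [m1 = m1'] (mod (LEAST k. meet_moved q \<mu> k)) \<and>
              [m1' = m1''] (mod (LEAST k. meet_moved q \<mu> k)))))"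

end

theory Submission
  imports Defs
begin

text \<open>
  Extend \<open>p\<close> by an automorphism \<open>\<sigma>\<close> sending \<open>\<xi>\<^sub>n\<close> to \<open>v\<close> and by another one sending it to \<open>w\<close>.
  If no meet \<open>\<xi>\<^sub>0 \<and> \<xi>\<^sub>l\<close> were moved by \<open>\<sigma>\<^sup>l\<close>, one could modify \<open>\<sigma>\<close> outside \<open>p\<close> so that either some
  such meet is moved with period greater than \<open>n / 2\<close> or \<open>\<xi>\<close> becomes cyclic, and PEC forbids both.
  Hence there is a least \<open>k\<close> such that the meets \<open>c\<^sub>i = \<xi>\<^sub>i \<and> \<xi>\<^sub>i\<^sub>+\<^sub>k\<close> form strictly monotone chains along
  the residue classes modulo \<open>k\<close>; moreover \<open>2 k \<le> n\<close>, so \<open>k\<close> is visible in \<open>p\<close>. Now \<open>p\<close> determines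
  the position of \<open>v\<close> relative to its range, and an initial point \<open>x\<close> can only be compared with the
  last visible element \<open>g\<close> of the chain: if \<open>g \<le> x\<close>, then PEC makes \<open>x\<close> share, seen from \<open>v\<close>, the
  branch of a point of the range (\<open>p\<^sup>k(x)\<close>, which exists because the orbit of \<open>x\<close> is not shorter
  than \<open>\<xi>\<close>, or \<open>\<xi>\<^sub>n\<^sub>+\<^sub>1\<^sub>-\<^sub>k\<close>); otherwise \<open>v\<close> and \<open>w\<close> branch off from \<open>x\<close> together.
\<close>

section \<open>Automorphisms of meet-semilattices\<close>

definition automorphism :: "('a::semilattice_inf \<Rightarrow> 'a) \<Rightarrow> bool" where
  "automorphism f \<longleftrightarrow> bij f \<and> (\<forall>x y. f (inf x y) = inf (f x) (f y))"

lemma automorphism_inf: "automorphism f \<Longrightarrow> f (inf x y) = inf (f x) (f y)"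
  by (simp add: automorphism_def)

lemma automorphism_inj: "automorphism f \<Longrightarrow> f x = f y \<longleftrightarrow> x = y"
  by (auto simp: automorphism_def bij_def inj_def)

lemma automorphism_le: "automorphism f \<Longrightarrow> f x \<le> f y \<longleftrightarrow> x \<le> y"
  by (metis automorphism_inf automorphism_inj inf.absorb_iff1)

lemma automorphism_less: "automorphism f \<Longrightarrow> f x < f y \<longleftrightarrow> x < y"
  by (simp add: automorphism_le less_le_not_le)

lemma automorphism_comp: "automorphism f \<Longrightarrow> automorphism g \<Longrightarrow> automorphism (f \<circ> g)"
  by (auto simp: automorphism_def bij_comp)

lemma automorphism_funpow: "automorphism f \<Longrightarrow> automorphism (f ^^ n)"
proof (induction n)
  case 0
  show ?case by (simp add: automorphism_def bij_id[unfolded id_def] id_def)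
next
  case (Suc n)
  then show ?case using automorphism_comp[OF Suc.prems Suc.IH] by (simp del: o_apply)
qed

lemma automorphism_inv: "automorphism f \<Longrightarrow> automorphism (inv f)"
  unfolding automorphism_def
  by (metis bij_imp_bij_inv bij_inv_eq_iff)

lemma funpow_inv_cancel:
  fixes f :: "'a \<Rightarrow> 'a"
  shows "bij f \<Longrightarrow> (f ^^ n) ((inv f ^^ n) x) = x"
proof (induction n arbitrary: x)
  case (Suc n)
  have "(f ^^ Suc n) ((inv f ^^ Suc n) x) = f ((f ^^ n) ((inv f ^^ n) (inv f x)))"
    by (simp add: funpow_swap1)
  with Suc show ?case by (simp add: bij_is_surj surj_f_inv_f)
qed simp

lemma funpow_add_apply: "(f ^^ m) ((f ^^ n) x) = (f ^^ (m + n)) x"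
  by (simp add: funpow_add)

lemma funpow_fixed_mult: "(f ^^ t) x = x \<Longrightarrow> (f ^^ (t * q)) x = x"
  by (induction q) (simp_all add: funpow_add)

text \<open>Monotonicity turns one comparison into a chain such as
  \<open>x \<le> h x \<le> ... \<le> (h ^^ t) x = x\<close>, which collapses.\<close>

lemma automorphism_comparable_fixed:
  assumes "automorphism h" and "(h ^^ t) x = x" and "0 < t" and "x \<le> h x \<or> h x \<le> x"
  shows "h x = x"
proof -
  obtain s where t: "t = Suc s" using \<open>0 < t\<close> gr0_implies_Suc by blast
  from assms(4) show ?thesis
  proof
    assume le: "x \<le> h x"
    have "x \<le> (h ^^ n) x" for n
    proof (induction n)
      case (Suc n)
      have "h x \<le> h ((h ^^ n) x)" using Suc assms(1) by (simp add: automorphism_le)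
      with le show ?case by simp
    qed simp
    then have "h x \<le> h ((h ^^ s) x)" using assms(1) by (simp add: automorphism_le)
    with assms(2) t have "h x \<le> x" by simp
    with le show ?thesis by simp
  next
    assume le: "h x \<le> x"
    have "(h ^^ n) x \<le> x" for n
    proof (induction n)
      case (Suc n)
      have "h ((h ^^ n) x) \<le> h x" using Suc assms(1) by (simp add: automorphism_le)
      with le show ?case by simp
    qed simp
    then have "h ((h ^^ s) x) \<le> h x" using assms(1) by (simp add: automorphism_le)
    with assms(2) t have "x \<le> h x" by simp
    with le show ?thesis by simp
  qed
qed

section \<open>Automorphisms preserve first-order types\<close>

lemma tm_val_automorphism:
  assumes "automorphism f"
  shows "\<forall>a\<in>tm_params t. f a = a \<Longrightarrow> tm_val (\<lambda>i. f (e i)) t = f (tm_val e t)"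
  by (induction t) (simp_all add: automorphism_inf[OF assms])

lemma sat_automorphism:
  assumes "automorphism f"
  shows "\<forall>a\<in>fm_params \<phi>. f a = a \<Longrightarrow> sat (\<lambda>i. f (e i)) \<phi> \<longleftrightarrow> sat e \<phi>"
proof (induction \<phi> arbitrary: e)
  case (Ex i \<phi>)
  have upd: "(\<lambda>j. f ((e(i := x)) j)) = (\<lambda>j. f (e j))(i := f x)" for x
    by auto
  have IH: "sat ((\<lambda>j. f (e j))(i := f x)) \<phi> \<longleftrightarrow> sat (e(i := x)) \<phi>" for x
  proof -
    have "sat (\<lambda>j. f ((e(i := x)) j)) \<phi> \<longleftrightarrow> sat (e(i := x)) \<phi>"
      by (rule Ex.IH) (use Ex.prems in auto)
    then show ?thesis unfolding upd .
  qed
  \<comment> \<open>Surjectivity supplies the witnesses needed for the existential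
    quantifier.\<close>
  have surj: "\<exists>x. y = f x" for y
    using assms unfolding automorphism_def bij_def surj_def by blast
  have "(\<exists>y. sat ((\<lambda>j. f (e j))(i := y)) \<phi>) \<longleftrightarrow> (\<exists>x. sat (e(i := x)) \<phi>)"
  proof
    assume "\<exists>y. sat ((\<lambda>j. f (e j))(i := y)) \<phi>"
    then obtain y where y: "sat ((\<lambda>j. f (e j))(i := y)) \<phi>" by blast
    obtain x where "y = f x" using surj by blast
    with y IH show "\<exists>x. sat (e(i := x)) \<phi>" by blast
  qed (use IH in blast)
  then show ?case by (simp only: sat.simps)
qed (simp_all add: tm_val_automorphism[OF assms] automorphism_le[OF assms] automorphism_inj[OF assms])

lemma tm_val_cong: "\<forall>i\<in>tm_vars t. e i = e' i \<Longrightarrow> tm_val e t = tm_val e' t"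
  by (induction t) auto

lemma sat_cong: "\<forall>i\<in>free_vars \<phi>. e i = e' i \<Longrightarrow> sat e \<phi> \<longleftrightarrow> sat e' \<phi>"
proof (induction \<phi> arbitrary: e e')
  case (Le s t)
  then show ?case using tm_val_cong[of s e e'] tm_val_cong[of t e e'] by simp
next
  case (Eq s t)
  then show ?case using tm_val_cong[of s e e'] tm_val_cong[of t e e'] by simp
next
  case (Conj \<phi> \<psi>)
  have "sat e \<phi> \<longleftrightarrow> sat e' \<phi>" by (rule Conj.IH(1)) (use Conj.prems in auto)
  moreover have "sat e \<psi> \<longleftrightarrow> sat e' \<psi>" by (rule Conj.IH(2)) (use Conj.prems in auto)
  ultimately show ?case by simp
next
  case (Ex i \<phi>)
  have "sat (e(i := x)) \<phi> \<longleftrightarrow> sat (e'(i := x)) \<phi>" for x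
    by (rule Ex.IH) (use Ex.prems in auto)
  then show ?case by simp
next
  case (Neg \<phi>)
  then show ?case using Neg.IH[of e e'] by simp
qed

lemma tp_automorphism:
  assumes "automorphism f" and "\<forall>a\<in>A. f a = a"
  shows "tp (map f xs) A = tp xs A"
proof -
  have "sat (\<lambda>i. map f xs ! i) \<phi> \<longleftrightarrow> sat (\<lambda>i. xs ! i) \<phi>"
    if "fm_params \<phi> \<subseteq> A" and "free_vars \<phi> \<subseteq> {..<length xs}" for \<phi>
  proof -
    have "sat (\<lambda>i. map f xs ! i) \<phi> \<longleftrightarrow> sat (\<lambda>i. f (xs ! i)) \<phi>"
      by (rule sat_cong) (use that in auto)
    also have "\<dots> \<longleftrightarrow> sat (\<lambda>i. xs ! i) \<phi>"
      by (rule sat_automorphism[OF assms(1)]) (use that assms(2) in auto)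
    finally show ?thesis .
  qed
  then show ?thesis unfolding tp_def by auto
qed

section \<open>Partial automorphisms and the atomic relations between triples\<close>

definition graph_of :: "('a \<Rightarrow> 'a) \<Rightarrow> ('a \<times> 'a) set" where
  "graph_of f = {(x, f x) | x. True}"

lemma in_graph_of [simp]: "(x, y) \<in> graph_of f \<longleftrightarrow> y = f x"
  by (auto simp: graph_of_def)

lemma graph_of_relpow: "(x, y) \<in> graph_of f ^^ n \<longleftrightarrow> y = (f ^^ n) x"
  by (induction n arbitrary: y) (auto simp: relcomp_unfold)

lemma partial_automorphism_graph_of:
  assumes "automorphism f"
  shows "partial_automorphism (graph_of f)"
  unfolding partial_automorphism_def
proof (intro conjI allI impI)
  show "single_valued (graph_of f)" by (auto simp: single_valued_def)
next
  fix ps assume "set ps \<subseteq> graph_of f"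
  then have "map snd ps = map f (map fst ps)" by (auto simp: graph_of_def)
  then have "tp (map snd ps) {} = tp (map fst ps) {}"
    using tp_automorphism[OF assms, of "{}" "map fst ps"] by (simp del: map_map)
  then show "qftp (map fst ps) = qftp (map snd ps)" by (simp add: qftp_def)
qed

lemma qftp_inf_le:
  assumes "qftp xs = qftp ys" and "length xs = length ys"
    and "i < length xs" "j < length xs" "k < length xs"
  shows "inf (xs ! i) (xs ! j) \<le> xs ! k \<longleftrightarrow> inf (ys ! i) (ys ! j) \<le> ys ! k"
proof -
  let ?\<phi> = "Le (Meet (Var i) (Var j)) (Var k)"
  have "?\<phi> \<in> qftp xs \<longleftrightarrow> ?\<phi> \<in> qftp ys" using assms(1) by simp
  then show ?thesis using assms by (simp add: qftp_def tp_def)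
qed

text \<open>In a meet-tree a meet of finitely many points is already a meet of two of them, so these
  relations generate all the atomic ones. Repeated entries are allowed; \<open>x = y\<close> gives
  the order itself.\<close>

definition preserves_triples :: "('a::semilattice_inf \<times> 'a) set \<Rightarrow> bool" where
  "preserves_triples p \<longleftrightarrow>
     (\<forall>(x, x')\<in>p. \<forall>(y, y')\<in>p. \<forall>(z, z')\<in>p. inf x y \<le> z \<longleftrightarrow> inf x' y' \<le> z')"

lemma preserves_triplesD:
  "preserves_triples p \<Longrightarrow> (x, x') \<in> p \<Longrightarrow> (y, y') \<in> p \<Longrightarrow> (z, z') \<in> p \<Longrightarrow>
     inf x y \<le> z \<longleftrightarrow> inf x' y' \<le> z'"
  unfolding preserves_triples_def by fast

lemma partial_automorphism_preserves_triples:
  assumes "partial_automorphism p"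
  shows "preserves_triples p"
  unfolding preserves_triples_def
proof (clarify)
  fix x x' y y' z z' assume *: "(x, x') \<in> p" "(y, y') \<in> p" "(z, z') \<in> p"
  let ?ps = "[(x, x'), (y, y'), (z, z')]"
  have "set ?ps \<subseteq> p" using * by simp
  then have "qftp (map fst ?ps) = qftp (map snd ?ps)"
    using assms unfolding partial_automorphism_def by blast
  from qftp_inf_le[OF this, of 0 1 2] show "inf x y \<le> z \<longleftrightarrow> inf x' y' \<le> z'" by simp
qed

section \<open>The universal meet-tree\<close>

locale universal_tree =
  fixes T :: "'a::semilattice_inf itself"
  assumes universal: "universal_meet_tree T"
begin

lemma below_linear: "x \<le> a \<Longrightarrow> y \<le> a \<Longrightarrow> x \<le> y \<or> y \<le> x" for a x y :: 'a
proof -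
  assume "x \<le> a" "y \<le> a"
  have "totalp_on {x. x \<le> a} (\<le>)"
    using universal unfolding universal_meet_tree_def meet_tree_on_def by simp
  with \<open>x \<le> a\<close> \<open>y \<le> a\<close> show ?thesis by (auto simp: totalp_on_def)
qed

text \<open>\<open>inf x y\<close> and \<open>g\<close> both lie below \<open>y\<close>, hence are
  comparable, and \<open>g \<le> inf x y\<close> would give \<open>g \<le> x\<close>. So a point may
  be replaced by anything below it that is not below the other point; nearly all later computations
  of meets rest on this.\<close>

lemma inf_cut:
  fixes g x y :: 'a
  assumes "g \<le> y" and "\<not> g \<le> x"
  shows "inf x y = inf x g"
proof -
  have "inf x y \<le> g"
    using below_linear[of "inf x y" y g] assms by auto
  then show ?thesis using assms(1) by (simp add: order.antisym le_infI2)
qed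

text \<open>The meets of \<open>x\<close> with the other points form a chain below \<open>x\<close>,
  and the least of them is the meet of all four. Hence pairwise meets of a set are closed under
  meets.\<close>

lemma inf4_eq_inf2:
  fixes x y z u :: 'a
  shows "\<exists>a\<in>{x, y, z, u}. \<exists>b\<in>{x, y, z, u}. inf (inf x y) (inf z u) = inf a b"
proof -
  have min2: "inf a b \<in> {a, b}" if "a \<le> x" "b \<le> x" for a b
    using below_linear[OF that] by (auto simp: inf.absorb1 inf.absorb2)
  have "inf (inf x y) (inf z u) = inf (inf x y) (inf (inf x z) (inf x u))"
    by (simp add: inf.left_commute inf.assoc)
  also have "\<dots> \<in> {inf x y, inf x z, inf x u}"
    using min2[of "inf x z" "inf x u"] min2[of "inf x y" "inf x z"] min2[of "inf x y" "inf x u"] by auto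
  finally show ?thesis by blast
qed

lemma homogeneous:
  fixes f :: "'a \<Rightarrow> 'a"
  assumes "finite A" and "meet_closed A" and "embedding_on A (\<le>) inf f"
  shows "\<exists>g. automorphism g \<and> (\<forall>x\<in>A. g x = f x)"
proof -
  have homog: "\<forall>(A :: 'a set) (f :: 'a \<Rightarrow> 'a).
      finite A \<longrightarrow> meet_closed A \<longrightarrow> embedding_on A (\<le>) inf f \<longrightarrow>
      (\<exists>g. bij g \<and> embedding_on UNIV (\<le>) inf g \<and> (\<forall>x\<in>A. g x = f x))"
    using universal unfolding universal_meet_tree_def by (elim conjE)
  obtain g where g: "bij g" "embedding_on UNIV (\<le>) inf g" "\<forall>x\<in>A. g x = f x"
    using mp[OF mp[OF mp[OF spec[OF spec[OF homog]] assms(1)] assms(2)] assms(3)]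
    by (elim exE conjE)
  have "automorphism g" using g(1,2) by (simp add: automorphism_def embedding_on_def)
  with g(3) show ?thesis by (intro exI[of _ g] conjI)
qed

text \<open>The map extends to pairwise meets, where it is an embedding of a finite meet-closed set,
  so ultrahomogeneity applies.\<close>

lemma extend_to_automorphism:
  fixes p :: "('a \<times> 'a) set"
  assumes "finite p" and "preserves_triples p"
  shows "\<exists>f. automorphism f \<and> (\<forall>(x, x')\<in>p. f x = x')"
proof -
  \<comment> \<open>The extension of \<open>p\<close> to pairwise meets, as a relation; that it is a
    function follows from preservation of the order.\<close>
  define P where "P = {(a, a'). \<exists>x x' y y'. (x, x') \<in> p \<and> (y, y') \<in> p \<and> a = inf x y \<and> a' = inf x' y'}"
  have P_iff: "(a, a') \<in> P \<longleftrightarrow> (\<exists>x x' y y'. (x, x') \<in> p \<and> (y, y') \<in> p \<and> a = inf x y \<and> a' = inf x' y')"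
    for a a' unfolding P_def by (simp only: mem_Collect_eq case_prod_conv)
  have "Domain P \<subseteq> (\<lambda>(x, y). inf x y) ` (Domain p \<times> Domain p)"
  proof
    fix a assume "a \<in> Domain P"
    then obtain a' where "(a, a') \<in> P" by (rule DomainE)
    then obtain x x' y y' where *: "(x, x') \<in> p" "(y, y') \<in> p" "a = inf x y"
      unfolding P_iff by (elim exE conjE)
    have "(x, y) \<in> Domain p \<times> Domain p" using *(1,2) by (intro SigmaI DomainI)
    then show "a \<in> (\<lambda>(x, y). inf x y) ` (Domain p \<times> Domain p)"
      by (rule rev_image_eqI) (simp add: *(3))
  qed
  then have finite_Domain_P: "finite (Domain P)"
    by (rule finite_subset) (simp add: finite_Domain assms(1))
  have P_I: "(inf x y, inf x' y') \<in> P" if "(x, x') \<in> p" "(y, y') \<in> p" for x x' y y'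
    by (rule iffD2[OF P_iff], rule exI[of _ x], rule exI[of _ x'], rule exI[of _ y], rule exI[of _ y'])
      (use that in simp)
  have P_le: "a \<le> b \<longleftrightarrow> a' \<le> b'" if ab: "(a, a') \<in> P" "(b, b') \<in> P" for a a' b b'
  proof -
    obtain x x' y y' where *: "(x, x') \<in> p" "(y, y') \<in> p" "a = inf x y" "a' = inf x' y'"
      using iffD1[OF P_iff ab(1)] by (elim exE conjE)
    obtain z z' u u' where **: "(z, z') \<in> p" "(u, u') \<in> p" "b = inf z u" "b' = inf z' u'"
      using iffD1[OF P_iff ab(2)] by (elim exE conjE)
    show ?thesis
      using preserves_triplesD[OF assms(2) *(1,2) **(1)] preserves_triplesD[OF assms(2) *(1,2) **(2)]
        *(3,4) **(3,4)
      by simp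
  qed
  have P_inf: "\<exists>c'. (inf a b, c') \<in> P" if ab: "(a, a') \<in> P" "(b, b') \<in> P" for a a' b b'
  proof -
    obtain x x' y y' where *: "(x, x') \<in> p" "(y, y') \<in> p" "a = inf x y"
      using iffD1[OF P_iff ab(1)] by (elim exE conjE)
    obtain z z' u u' where **: "(z, z') \<in> p" "(u, u') \<in> p" "b = inf z u"
      using iffD1[OF P_iff ab(2)] by (elim exE conjE)
    obtain s t where st: "s \<in> {x, y, z, u}" "t \<in> {x, y, z, u}" "inf (inf x y) (inf z u) = inf s t"
      using inf4_eq_inf2[of x y z u] by (elim bexE)
    have "\<exists>s'. (s, s') \<in> p" "\<exists>t'. (t, t') \<in> p" using st(1,2) *(1,2) **(1,2) by auto
    then obtain s' t' where "(s, s') \<in> p" "(t, t') \<in> p" by blast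
    from P_I[OF this] show ?thesis unfolding *(3) **(3) st(3) ..
  qed
  have P_inf': "\<exists>c. (c, inf a' b') \<in> P" if ab: "(a, a') \<in> P" "(b, b') \<in> P" for a a' b b'
  proof -
    obtain x x' y y' where *: "(x, x') \<in> p" "(y, y') \<in> p" "a' = inf x' y'"
      using iffD1[OF P_iff ab(1)] by (elim exE conjE)
    obtain z z' u u' where **: "(z, z') \<in> p" "(u, u') \<in> p" "b' = inf z' u'"
      using iffD1[OF P_iff ab(2)] by (elim exE conjE)
    obtain s' t' where st: "s' \<in> {x', y', z', u'}" "t' \<in> {x', y', z', u'}" "inf (inf x' y') (inf z' u') = inf s' t'"
      using inf4_eq_inf2[of x' y' z' u'] by (elim bexE)
    have "\<exists>s. (s, s') \<in> p" "\<exists>t. (t, t') \<in> p" using st(1,2) *(1,2) **(1,2) by auto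
    then obtain s t where "(s, s') \<in> p" "(t, t') \<in> p" by blast
    from P_I[OF this] show ?thesis unfolding *(3) **(3) st(3) ..
  qed
  have P_fun: "a' = a''" if "(a, a') \<in> P" "(a, a'') \<in> P" for a a' a''
    using P_le[OF that] P_le[OF that(2) that(1)] by simp
  define f where "f a = (THE a'. (a, a') \<in> P)" for a
  have f_eq: "f a = a'" if "(a, a') \<in> P" for a a'
    unfolding f_def using that P_fun by (intro the_equality) auto
  \<comment> \<open>One inequality is preservation of the order. For the other,
    \<open>inf a' b'\<close> must itself be the image of some point \<open>c\<close>, which then
    lies below both \<open>a\<close> and \<open>b\<close>.\<close>
  have f_inf: "f (inf a b) = inf a' b'" if ab: "(a, a') \<in> P" "(b, b') \<in> P" for a a' b b'
  proof -
    obtain c' where c': "(inf a b, c') \<in> P" using P_inf[OF ab] by blast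
    obtain c where c: "(c, inf a' b') \<in> P" using P_inf'[OF ab] by blast
    have "c' \<le> inf a' b'"
      using P_le[OF c' ab(1)] P_le[OF c' ab(2)] by simp
    moreover have "c \<le> inf a b"
      using P_le[OF c ab(1)] P_le[OF c ab(2)] by simp
    then have "inf a' b' \<le> c'" using P_le[OF c c'] by simp
    ultimately show ?thesis using f_eq[OF c'] by (simp add: order.antisym)
  qed
  have "meet_closed (Domain P)" using P_inf by blast
  moreover have "embedding_on (Domain P) (\<le>) inf f"
    unfolding embedding_on_def inj_on_def
  proof (intro conjI ballI impI)
    fix a b assume "a \<in> Domain P" "b \<in> Domain P"
    then obtain a' b' where ab: "(a, a') \<in> P" "(b, b') \<in> P" by blast
    show "a \<le> b \<longleftrightarrow> f a \<le> f b" using P_le[OF ab] f_eq[OF ab(1)] f_eq[OF ab(2)] by simp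
    show "f (inf a b) = inf (f a) (f b)" using f_inf[OF ab] f_eq[OF ab(1)] f_eq[OF ab(2)] by simp
    assume "f a = f b"
    then show "a = b"
      using P_le[OF ab] P_le[OF ab(2) ab(1)] f_eq[OF ab(1)] f_eq[OF ab(2)] by (simp add: order.antisym)
  qed
  ultimately obtain g where g: "automorphism g" "\<forall>x\<in>Domain P. g x = f x"
    using homogeneous[OF finite_Domain_P] by blast
  have "g x = x'" if "(x, x') \<in> p" for x x'
  proof -
    have "(x, x') \<in> P" using P_I[OF that that] by simp
    then show ?thesis using g(2) f_eq by auto
  qed
  then show ?thesis using g(1) by blast
qed

section \<open>Density, and moving a point over a finite set\<close>

lemma dense:
  fixes a b :: 'a
  assumes "a < b"
  shows "\<exists>c. a < c \<and> c < b"
proof -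
  \<comment> \<open>Universality embeds a three-element chain; homogeneity then carries its end
    points to \<open>a\<close> and \<open>b\<close>, and its middle point between them.\<close>
  have chain: "meet_tree_on {0, 1, 2 :: nat} (\<le>) min"
    unfolding meet_tree_on_def reflp_on_def antisymp_on_def transp_on_def totalp_on_def
    by (simp add: min_def nat_le_linear)
  have "\<forall>(V :: nat set) le mt. finite V \<longrightarrow> meet_tree_on V le mt \<longrightarrow>
      (\<exists>f :: nat \<Rightarrow> 'a. embedding_on V le mt f)"
    using universal unfolding universal_meet_tree_def by (elim conjE)
  from spec[OF spec[OF spec[OF this]], of "{0, 1, 2}" "(\<le>)" min] chain
  obtain e :: "nat \<Rightarrow> 'a" where e: "embedding_on {0, 1, 2} (\<le>) min e" by auto
  have "e i \<le> e j \<longleftrightarrow> i \<le> j" if "i \<in> {0, 1, 2}" "j \<in> {0, 1, 2}" for i j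
  proof -
    have "\<forall>x\<in>{0, 1, 2}. \<forall>y\<in>{0, 1, 2}. (x \<le> y \<longleftrightarrow> e x \<le> e y) \<and> e (min x y) = inf (e x) (e y)"
      using e unfolding embedding_on_def by (elim conjE)
    from bspec[OF bspec[OF this that(1)] that(2)] show ?thesis by simp
  qed
  from this[of 0 1] this[of 1 0] this[of 1 2] this[of 2 1] have lt: "e 0 < e 1" "e 1 < e 2"
    by (simp_all add: less_le_not_le)
  then have lt2: "e 0 < e 2" by simp
  have "preserves_triples {(e 0, a), (e 2, b)}"
    using assms lt2 unfolding preserves_triples_def less_le_not_le
    by (simp add: inf.absorb1 inf.absorb2)
  then obtain f where f: "automorphism f" "f (e 0) = a" "f (e 2) = b"
    using extend_to_automorphism[of "{(e 0, a), (e 2, b)}"] by auto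
  have "a < f (e 1)" "f (e 1) < b"
    using lt automorphism_less[OF f(1), of "e 0" "e 1"] automorphism_less[OF f(1), of "e 1" "e 2"] f(2,3)
    by simp_all
  then show ?thesis by (intro exI[of _ "f (e 1)"] conjI)
qed

text \<open>Up to symmetry and trivial cases, the assumptions list the triples containing
  \<open>a\<close> for the map that fixes \<open>F\<close> and sends \<open>a\<close> to
  \<open>b\<close>.\<close>

lemma extend_point:
  fixes F :: "'a set" and a b :: 'a
  assumes "finite F"
    and "\<And>x. x \<in> F \<Longrightarrow> a \<le> x \<longleftrightarrow> b \<le> x"
    and "\<And>x y. x \<in> F \<Longrightarrow> y \<in> F \<Longrightarrow> inf a x \<le> y \<longleftrightarrow> inf b x \<le> y"
    and "\<And>x y. x \<in> F \<Longrightarrow> y \<in> F \<Longrightarrow> inf x y \<le> a \<longleftrightarrow> inf x y \<le> b"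
  shows "\<exists>f. automorphism f \<and> (\<forall>x\<in>F. f x = x) \<and> f a = b"
proof -
  let ?p = "insert (a, b) ((\<lambda>x. (x, x)) ` F)"
  have 3: "inf x a \<le> y \<longleftrightarrow> inf x b \<le> y" if "x \<in> F" "y \<in> F" for x y
    using assms(3)[OF that] by (simp add: inf.commute)
  have 4: "x \<le> a \<longleftrightarrow> x \<le> b" if "x \<in> F" for x
    using assms(4)[OF that that] by simp
  have "preserves_triples ?p"
    unfolding preserves_triples_def using assms(2-4) 3 4 by auto
  moreover have "finite ?p" using assms(1) by simp
  ultimately obtain f where "automorphism f" "\<forall>(x, x')\<in>?p. f x = x'"
    using extend_to_automorphism by blast
  then show ?thesis by auto
qed

text \<open>On the branch towards \<open>t\<close>, let \<open>h\<close> be the first meet with a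
  point of \<open>F\<close> above \<open>d\<close>. Since \<open>d\<close> is not such a meet,
  \<open>d < h\<close>, and every point strictly between them has the same position over
  \<open>F\<close> as \<open>d\<close>.\<close>

lemma move_in_gap:
  fixes F :: "'a set" and d t :: 'a
  assumes "finite F" and "t \<in> F" and "d \<le> t"
    and not_meet: "\<And>x y. x \<in> F \<Longrightarrow> y \<in> F \<Longrightarrow> d \<noteq> inf x y"
  shows "\<exists>f. automorphism f \<and> (\<forall>x\<in>F. f x = x) \<and> f d \<noteq> d"
proof -
  \<comment> \<open>All these meets lie below \<open>t\<close>, so a minimal one is the least
    one.\<close>
  let ?M = "(\<lambda>x. inf t x) ` {x \<in> F. d \<le> x}"
  have "finite ?M" "?M \<noteq> {}" using assms(1-3) by auto
  from finite_has_minimal[OF this] obtain h where h: "h \<in> ?M" "\<forall>m\<in>?M. m \<le> h \<longrightarrow> h = m" ..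
  then obtain x0 where x0: "x0 \<in> F" "d \<le> x0" "h = inf t x0" by auto
  have "d \<le> h" using assms(3) x0(2,3) by simp
  with not_meet[OF assms(2) x0(1)] x0(3) have "d < h" by (simp add: less_le)
  have h_least: "h \<le> x" if "x \<in> F" "d \<le> x" for x
  proof -
    have mem: "inf t x \<in> ?M" using that by (intro imageI) simp
    have "inf t x \<le> h \<or> h \<le> inf t x"
      using below_linear[of "inf t x" t h] x0(3) by simp
    then have "h \<le> inf t x" using bspec[OF h(2) mem] by auto
    then show ?thesis by simp
  qed
  obtain e where e: "d < e" "e < h" using dense[OF \<open>d < h\<close>] by blast
  have up: "d \<le> x \<longleftrightarrow> e \<le> x" if "x \<in> F" for x
    using h_least[OF that] e order.trans[of d e x] order.trans[of e h x] by auto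
  have "\<exists>f. automorphism f \<and> (\<forall>x\<in>F. f x = x) \<and> f d = e"
  proof (rule extend_point[OF assms(1) up])
    fix x y assume xy: "x \<in> F" "y \<in> F"
    show "inf d x \<le> y \<longleftrightarrow> inf e x \<le> y"
    proof (cases "d \<le> x")
      case True
      then show ?thesis using up[OF xy(1)] up[OF xy(2)] by (simp add: inf.absorb1)
    next
      case False
      then have "inf x e = inf x d" using inf_cut[of d e x] e by simp
      then show ?thesis by (simp add: inf.commute)
    qed
    show "inf x y \<le> d \<longleftrightarrow> inf x y \<le> e"
    proof
      assume "inf x y \<le> e"
      show "inf x y \<le> d"
      proof (rule ccontr)
        assume "\<not> inf x y \<le> d"
        then have "d \<le> inf x y" using below_linear[OF \<open>inf x y \<le> e\<close>, of d] e by auto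
        then have "h \<le> inf x y" using h_least xy by simp
        also note \<open>inf x y \<le> e\<close>
        also note \<open>e < h\<close>
        finally show False by simp
      qed
    qed (use e in auto)
  qed
  then show ?thesis using e(1) by (elim exE conjE) (intro exI conjI, auto)
qed

end

section \<open>Moved meets along an orbit\<close>

text \<open>The last two assumptions make \<open>k\<close> the least exponent whose meet with
  \<open>x\<close> is moved.\<close>

locale spiral = universal_tree T for T :: "'a::semilattice_inf itself" +
  fixes \<sigma> :: "'a \<Rightarrow> 'a" and x :: 'a and k :: nat
  assumes aut: "automorphism \<sigma>" and k_pos: "0 < k"
    and fixed: "\<And>l. 0 < l \<Longrightarrow> l < k \<Longrightarrow>
      inf x ((\<sigma> ^^ l) x) = inf ((\<sigma> ^^ l) x) ((\<sigma> ^^ (2 * l)) x)"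
    and moved: "inf x ((\<sigma> ^^ k) x) \<noteq> inf ((\<sigma> ^^ k) x) ((\<sigma> ^^ (2 * k)) x)"
begin

definition X :: "nat \<Rightarrow> 'a" where "X i = (\<sigma> ^^ i) x"

definition c :: "nat \<Rightarrow> 'a" where "c i = inf (X i) (X (i + k))"

lemma shift_X: "(\<sigma> ^^ j) (X i) = X (i + j)"
  unfolding X_def by (simp add: funpow_add_apply add.commute)

lemma shift_inf: "(\<sigma> ^^ j) (inf a b) = inf ((\<sigma> ^^ j) a) ((\<sigma> ^^ j) b)"
  by (rule automorphism_inf[OF automorphism_funpow[OF aut]])

lemma shift_le: "(\<sigma> ^^ j) a \<le> (\<sigma> ^^ j) b \<longleftrightarrow> a \<le> b"
  by (rule automorphism_le[OF automorphism_funpow[OF aut]])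

lemma shift_less: "(\<sigma> ^^ j) a < (\<sigma> ^^ j) b \<longleftrightarrow> a < b"
  by (rule automorphism_less[OF automorphism_funpow[OF aut]])

lemma shift_c: "(\<sigma> ^^ j) (c i) = c (i + j)"
  unfolding c_def shift_inf shift_X by (simp add: ac_simps)

lemma c_le: "c i \<le> X i" "c i \<le> X (i + k)"
  unfolding c_def by simp_all

text \<open>Both meets lie below \<open>X k\<close>, hence are comparable. The two directions behave
  differently and are treated separately from here on.\<close>

lemma inc_or_dec: "c 0 < c k \<or> c k < c 0"
proof -
  have "c 0 \<noteq> c k" using moved by (simp add: c_def X_def mult_2)
  moreover have "c 0 \<le> c k \<or> c k \<le> c 0"
    using below_linear[of "c 0" "X k" "c k"] c_le(2)[of 0] c_le(1)[of k] by simp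
  ultimately show ?thesis by (auto simp: less_le)
qed

lemma inc_step: "c 0 < c k \<Longrightarrow> c i < c (i + k)"
  using shift_less[of i "c 0" "c k"] by (simp add: shift_c add.commute)

lemma dec_step: "c k < c 0 \<Longrightarrow> c (i + k) < c i"
  using shift_less[of i "c k" "c 0"] by (simp add: shift_c add.commute)

lemma inc_mono: "c 0 < c k \<Longrightarrow> c i \<le> c (i + j * k)"
proof (induction j)
  case (Suc j)
  have "c (i + j * k) < c (i + j * k + k)" by (rule inc_step[OF Suc.prems])
  with Suc show ?case by (simp add: ac_simps)
qed simp

lemma dec_mono: "c k < c 0 \<Longrightarrow> c (i + j * k) \<le> c i"
proof (induction j)
  case (Suc j)
  have "c (i + j * k + k) < c (i + j * k)" by (rule dec_step[OF Suc.prems])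
  with Suc show ?case by (simp add: ac_simps)
qed simp

text \<open>\<open>X (i + j * k)\<close> lies above \<open>c (i + k)\<close>, whereas
  \<open>X i\<close> leaves the chain already at \<open>c i\<close>.\<close>

lemma inc_inf_X:
  assumes "c 0 < c k" and "0 < j"
  shows "inf (X i) (X (i + j * k)) = c i"
proof -
  obtain s where j: "j = Suc s" using assms(2) gr0_implies_Suc by blast
  have "c (i + k) \<le> c (i + k + s * k)" by (rule inc_mono[OF assms(1)])
  also have "\<dots> \<le> X (i + j * k)" using c_le(1)[of "i + k + s * k"] by (simp add: j ac_simps)
  finally have le: "c (i + k) \<le> X (i + j * k)" .
  have lt: "c i < c (i + k)" by (rule inc_step[OF assms(1)])
  have "\<not> c (i + k) \<le> X i"
  proof
    assume "c (i + k) \<le> X i"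
    then have "c (i + k) \<le> c i" using c_le(1)[of "i + k"] by (simp add: c_def)
    with lt show False by simp
  qed
  from inf_cut[OF le this] have "inf (X i) (X (i + j * k)) = inf (X i) (c (i + k))" .
  also have "\<dots> \<le> c i" using c_le(1)[of "i + k"] unfolding c_def[of i] by (meson inf_mono order.refl)
  finally have "inf (X i) (X (i + j * k)) \<le> c i" .
  moreover have "c i \<le> inf (X i) (X (i + j * k))"
    using c_le(1) le lt by (meson le_inf_iff less_imp_le order.trans)
  ultimately show ?thesis by (rule order.antisym)
qed

text \<open>Here the later point leaves the chain first: it does not lie above
  \<open>c (i + (j - 2) * k)\<close> when \<open>j \<ge> 2\<close>, and that element is below
  \<open>c i\<close>. Only an upper bound results.\<close>

lemma dec_inf_X_le:
  assumes "c k < c 0" and "0 < j"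
  shows "inf (X i) (X (i + j * k)) \<le> c i"
proof (cases "j = 1")
  case True
  then show ?thesis by (simp add: c_def)
next
  case False
  then obtain s where j: "j = Suc (Suc s)" using assms(2)
    by (metis One_nat_def gr0_implies_Suc not0_implies_Suc)
  let ?g = "c (i + s * k)"
  have g_le: "?g \<le> c i" by (rule dec_mono[OF assms(1)])
  have "\<not> ?g \<le> X (i + j * k)"
  proof
    assume "?g \<le> X (i + j * k)"
    then have "?g \<le> c (i + s * k + k)"
      using c_le(2)[of "i + s * k"] unfolding c_def[of "i + s * k + k"] by (simp add: j ac_simps)
    with dec_step[OF assms(1), of "i + s * k"] show False by simp
  qed
  from inf_cut[OF order.trans[OF g_le c_le(1)] this]
  have "inf (X (i + j * k)) (X i) = inf (X (i + j * k)) ?g" .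
  then show ?thesis using g_le by (metis inf.commute inf.coboundedI2)
qed

lemma inf_X_le: "0 < j \<Longrightarrow> inf (X i) (X (i + j * k)) \<le> c i"
  using inc_or_dec inc_inf_X dec_inf_X_le by fastforce

text \<open>By minimality of \<open>k\<close> the meet \<open>e i\<close> is unchanged under steps
  of length \<open>r\<close>, while the chain \<open>c\<close> changes strictly under steps of
  length \<open>k\<close>. Comparing both at a common multiple separates them.\<close>

lemma inf_X_residue_less:
  assumes "0 < r" and "r < k"
  shows "inf (X i) (X (i + r)) < c (i + j * k)" and "inf (X i) (X (i + r)) < c (i + r + j * k)"
proof -
  define e where "e i = inf (X i) (X (i + r))" for i
  have "e 0 = e r" using fixed[OF assms] by (simp add: e_def X_def mult_2)
  then have e_shift: "e i = e (i + r)" for i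
    using shift_inf[of i "X 0" "X r"] shift_inf[of i "X r" "X (r + r)"]
    by (simp add: e_def shift_X add.commute add.left_commute)
  have e_mult: "e i = e (i + r * s)" for i s
  proof (induction s)
    case (Suc s)
    then show ?case using e_shift[of "i + r * s"] by (simp add: ac_simps)
  qed simp
  have less0: "e i < c i" for i
  proof -
    have "e i \<le> X i" by (simp add: e_def)
    \<comment> \<open>The shift \<open>r * k\<close> is a multiple of \<open>r\<close>, so
      \<open>e\<close> keeps its value, and of \<open>k\<close>, so the bound for the chain
      applies.\<close>
    moreover have "e i \<le> X (i + r * k)" unfolding e_mult[of i k] by (simp add: e_def)
    ultimately have "e i \<le> inf (X i) (X (i + r * k))" by simp
    also have "\<dots> \<le> c i" by (rule inf_X_le[OF assms(1)])
    finally have le: "e i \<le> c i" .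
    moreover have "e i \<noteq> c i"
    proof
      assume eq: "e i = c i"
      have e_r: "e (i + r * k) = c (i + r * k)"
        using arg_cong[OF eq, of "\<sigma> ^^ (r * k)"]
        unfolding e_def shift_c shift_inf shift_X by (simp add: ac_simps)
      have "c i \<noteq> c (i + r * k)"
      proof -
        obtain s where r: "r = Suc s" using assms(1) gr0_implies_Suc by blast
        show ?thesis
          using inc_or_dec inc_step[of i] dec_step[of i] inc_mono[of "i + k" s] dec_mono[of "i + k" s]
          by (auto simp: r ac_simps)
      qed
      then show False using eq e_r e_mult[of i k] by simp
    qed
    ultimately show ?thesis by (simp add: less_le)
  qed
  have less: "e i < c (i + j * k)" for i j
    using inc_or_dec
  proof
    assume "c 0 < c k"
    then show ?thesis using less_le_trans[OF less0 inc_mono] by blast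
  next
    assume dec: "c k < c 0"
    obtain s where r: "r = Suc s" using assms(1) gr0_implies_Suc by blast
    \<comment> \<open>In the decreasing case the bound has to come from further along the chain:
      \<open>e\<close> is first moved, without changing, to an index beyond
      \<open>i + j * k\<close>.\<close>
    have "e i = e (i + r * (j * k))" by (rule e_mult)
    also have "\<dots> < c (i + r * (j * k))" by (rule less0)
    also have "\<dots> \<le> c (i + j * k)"
      using dec_mono[OF dec, of "i + j * k" "s * j"] by (simp add: r algebra_simps)
    finally show ?thesis .
  qed
  show "inf (X i) (X (i + r)) < c (i + j * k)" using less by (simp add: e_def)
  show "inf (X i) (X (i + r)) < c (i + r + j * k)" using less[of "i + r"] e_shift[of i] by (simp add: e_def)
qed

text \<open>Reducing \<open>l\<close> to its remainder \<open>r\<close> does not change the meet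
  with \<open>X i\<close>: the points \<open>X (i + r)\<close> and \<open>X (i + l)\<close> share a
  chain element \<open>g\<close> that is not below \<open>X i\<close>.\<close>

lemma inf_X_noncong_less:
  assumes "\<not> k dvd l"
  shows "inf (X i) (X (i + l)) < c (i + j * k)" and "inf (X i) (X (i + l)) < c (i + l + j * k)"
proof -
  define r q where "r = l mod k" and "q = l div k"
  have r: "0 < r" "r < k" using assms k_pos by (auto simp: r_def dvd_eq_mod_eq_0)
  have l: "l = r + q * k" by (simp add: r_def q_def)
  \<comment> \<open>The lower of the two chain elements, whichever direction the chain runs.\<close>
  define g where "g = (if c 0 < c k then c (i + r) else c (i + r + q * k))"
  have g: "g \<le> X (i + r)" "g \<le> X (i + r + q * k)"
    using inc_or_dec inc_mono[of "i + r" q] dec_mono[of "i + r" q] c_le(1)[of "i + r"] c_le(1)[of "i + r + q * k"]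
    unfolding g_def by (auto intro: order.trans)
  have e_less: "inf (X i) (X (i + r)) < g"
    using inf_X_residue_less(2)[OF r, of i 0] inf_X_residue_less(2)[OF r, of i q] by (simp add: g_def)
  have "\<not> g \<le> X i" 
  proof
    assume "g \<le> X i"
    with g(1) have "g \<le> inf (X i) (X (i + r))" by simp
    from leD[OF this] e_less show False by blast
  qed
  from inf_cut[OF g(2) this] inf_cut[OF g(1) this]
  have "inf (X i) (X (i + l)) = inf (X i) (X (i + r))" by (simp add: l ac_simps)
  then show "inf (X i) (X (i + l)) < c (i + j * k)" "inf (X i) (X (i + l)) < c (i + l + j * k)"
    using inf_X_residue_less(1)[OF r, of i j] inf_X_residue_less(2)[OF r, of i "q + j"]
    by (simp_all add: l algebra_simps)
qed

text \<open>Both halves of the previous lemma together, so that the order of \<open>a\<close> and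
  \<open>b\<close> no longer matters.\<close>

lemma noncong_less:
  assumes "\<not> [a = b] (mod k)" and "[a' = a] (mod k)" and "a \<le> a'"
  shows "inf (X a) (X b) < c a'"
proof -
  obtain j where a': "a' = a + j * k"
    using assms(2,3) by (metis cong_le_nat cong_sym add.commute)
  show ?thesis
  proof (cases "a \<le> b")
    case True
    then have "\<not> k dvd (b - a)" using assms(1) by (metis cong_altdef_nat cong_sym)
    from inf_X_noncong_less(1)[OF this, of a j] True a' show ?thesis by simp
  next
    case False
    then have "\<not> k dvd (a - b)" using assms(1) by (metis cong_altdef_nat nat_le_linear)
    from inf_X_noncong_less(2)[OF this, of b j] False a' show ?thesis by (simp add: inf.commute)
  qed
qed

lemma cong_le_obtain:
  fixes a b :: nat
  assumes "[a = b] (mod k)" and "a < b"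
  obtains j where "0 < j" and "b = a + j * k"
proof -
  obtain j where j: "b = a + j * k"
    using assms by (metis cong_le_nat cong_sym add.commute less_imp_le)
  moreover have "0 < j" using assms(2) j by (cases j) auto
  ultimately show thesis using that by blast
qed

lemma inc_inf_le:
  assumes "c 0 < c k" and "a \<noteq> m"
  shows "inf (X m) (X a) \<le> c m"
proof (cases "[m = a] (mod k)")
  case cong: True
  show ?thesis
  proof (cases "m < a")
    case True
    from cong_le_obtain[OF cong this] obtain j where "0 < j" "a = m + j * k" .
    then show ?thesis using inf_X_le by simp
  next
    case False
    then have "a < m" using assms(2) by simp
    from cong_le_obtain[OF cong_sym[OF cong] this] obtain j where j: "0 < j" "m = a + j * k" .
    then have "inf (X m) (X a) = c a" using inc_inf_X[OF assms(1) j(1), of a] by (simp add: inf.commute)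
    also have "\<dots> \<le> c m" using inc_mono[OF assms(1)] j by simp
    finally show ?thesis .
  qed
next
  case False
  from noncong_less[OF this cong_refl order.refl] show ?thesis by (rule less_imp_le)
qed

text \<open>In the same residue class \<open>c a \<le> X m\<close> would give
  \<open>c a \<le> c m\<close>, against strict increase. In different classes the meet of
  \<open>X a\<close> and \<open>X m\<close> is too low to lie above \<open>c a\<close>.\<close>

lemma inc_not_le:
  assumes "c 0 < c k" and "m < a"
  shows "\<not> c a \<le> X m"
proof
  assume le: "c a \<le> X m"
  show False
  proof (cases "[m = a] (mod k)")
    case True
    from cong_le_obtain[OF this assms(2)] obtain j where j: "0 < j" "a = m + j * k" .
    have "c a \<le> inf (X m) (X (m + j * k))" using le c_le(1)[of a] j(2) by simp
    also have "\<dots> = c m" by (rule inc_inf_X[OF assms(1) j(1)])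
    also have "\<dots> < c (m + k)" by (rule inc_step[OF assms(1)])
    also have "\<dots> \<le> c (m + k + (j - 1) * k)" by (rule inc_mono[OF assms(1)])
    also have "m + k + (j - 1) * k = a" using j by (cases j) auto
    finally show False by simp
  next
    case False
    then have "\<not> [a = m] (mod k)" by (simp add: cong_sym_eq)
    then have "inf (X a) (X m) < c a" by (rule noncong_less) simp_all
    moreover have "c a \<le> inf (X a) (X m)" using le c_le(1)[of a] by simp
    ultimately show False using leD by blast
  qed
qed

lemma dec_le:
  assumes "c k < c 0" and "[i = j] (mod k)" and "i \<le> j"
  shows "c j \<le> c i"
proof (cases "i = j")
  case False
  with assms(3) have "i < j" by simp
  from cong_le_obtain[OF assms(2) this] obtain s where "j = i + s * k" .
  then show ?thesis using dec_mono[OF assms(1)] by simp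
qed simp

lemma noncong_not_le:
  assumes "\<not> [a = b] (mod k)"
  shows "\<not> c a \<le> X b"
proof
  assume "c a \<le> X b"
  then have "c a \<le> inf (X a) (X b)" using c_le(1) by simp
  from leD[OF this] noncong_less[OF assms cong_refl order.refl] show False by blast
qed

end

section \<open>Orbits of pseudo existentially closed partial automorphisms\<close>

text \<open>Total automorphisms play the role of the partial extension \<open>q\<close> in
  \<open>PEC\<close>, so that all iterates exist.\<close>

definition extends :: "('a::semilattice_inf \<Rightarrow> 'a) \<Rightarrow> ('a \<times> 'a) set \<Rightarrow> bool" where
  "extends \<sigma> p \<longleftrightarrow> automorphism \<sigma> \<and> p \<subseteq> graph_of \<sigma>"

lemma extends_automorphism: "extends \<sigma> p \<Longrightarrow> automorphism \<sigma>"
  by (simp add: extends_def)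

lemma extends_apply: "extends \<sigma> p \<Longrightarrow> (x, y) \<in> p \<Longrightarrow> \<sigma> x = y"
  by (auto simp: extends_def)

lemma extends_relpow: "extends \<sigma> p \<Longrightarrow> (x, y) \<in> p ^^ m \<Longrightarrow> (\<sigma> ^^ m) x = y"
proof (induction m arbitrary: y)
  case (Suc m)
  from Suc.prems(2) obtain z where "(x, z) \<in> p ^^ m" "(z, y) \<in> p" by (rule relpow_Suc_E)
  with Suc show ?case by (simp add: extends_apply)
qed simp

text \<open>The device for modifying an extension: following it by an automorphism that fixes the
  range leaves its values on \<open>p\<close> alone.\<close>

lemma extends_comp:
  assumes "extends \<sigma> p" and "automorphism \<theta>" and "\<And>y. y \<in> Range p \<Longrightarrow> \<theta> y = y"
  shows "extends (\<theta> \<circ> \<sigma>) p"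
  unfolding extends_def
proof
  show "automorphism (\<theta> \<circ> \<sigma>)"
    using assms(2) extends_automorphism[OF assms(1)] by (rule automorphism_comp)
  show "p \<subseteq> graph_of (\<theta> \<circ> \<sigma>)"
  proof
    fix e assume "e \<in> p"
    then have "(fst e, snd e) \<in> p" by simp
    then have "\<sigma> (fst e) = snd e" "\<theta> (snd e) = snd e"
      using extends_apply[OF assms(1)] assms(3)[OF RangeI, of "fst e" "snd e"] by simp_all
    then have "(fst e, snd e) \<in> graph_of (\<theta> \<circ> \<sigma>)" by (simp del: prod.collapse)
    then show "e \<in> graph_of (\<theta> \<circ> \<sigma>)" by (simp only: prod.collapse)
  qed
qed

text \<open>The trajectory of \<open>x\<close> is undisturbed until the first time at which \<theta>
  may move it.\<close>

lemma funpow_comp_fixing: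
  fixes \<theta> \<sigma> :: "'a \<Rightarrow> 'a"
  assumes "\<And>i. 0 < i \<Longrightarrow> i < t \<Longrightarrow> \<theta> ((\<sigma> ^^ i) x) = (\<sigma> ^^ i) x"
  shows "i < t \<Longrightarrow> ((\<theta> \<circ> \<sigma>) ^^ i) x = (\<sigma> ^^ i) x"
proof (induction i)
  case (Suc i)
  then have "((\<theta> \<circ> \<sigma>) ^^ i) x = (\<sigma> ^^ i) x" by (simp del: o_apply)
  then have "((\<theta> \<circ> \<sigma>) ^^ Suc i) x = \<theta> ((\<sigma> ^^ Suc i) x)" by simp
  also have "\<dots> = (\<sigma> ^^ Suc i) x" by (rule assms) (use Suc.prems in simp_all)
  finally show ?case .
qed simp

lemma funpow_comp_fixing_last:
  fixes \<theta> \<sigma> :: "'a \<Rightarrow> 'a"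
  assumes "\<And>i. 0 < i \<Longrightarrow> i < t \<Longrightarrow> \<theta> ((\<sigma> ^^ i) x) = (\<sigma> ^^ i) x" and "0 < t"
  shows "((\<theta> \<circ> \<sigma>) ^^ t) x = \<theta> ((\<sigma> ^^ t) x)"
proof -
  obtain s where t: "t = Suc s" using assms(2) gr0_implies_Suc by blast
  have "((\<theta> \<circ> \<sigma>) ^^ s) x = (\<sigma> ^^ s) x"
    by (rule funpow_comp_fixing[of t, OF assms(1)]) (simp_all add: t)
  then show ?thesis by (simp add: t)
qed

text \<open>Selected consequences of equality of quantifier-free types of triples with a common
  first entry; these are the ones that the applications of \<open>PEC\<close> compare.\<close>

definition same_triple :: "'a::semilattice_inf \<Rightarrow> 'a \<Rightarrow> 'a \<Rightarrow> 'a \<Rightarrow> 'a \<Rightarrow> bool" where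
  "same_triple a b c b' c' \<longleftrightarrow>
     (inf b c \<le> a \<longleftrightarrow> inf b' c' \<le> a) \<and> (inf a c \<le> b \<longleftrightarrow> inf a c' \<le> b') \<and>
     (inf a b \<le> c \<longleftrightarrow> inf a b' \<le> c') \<and>
     (b \<le> c \<longleftrightarrow> b' \<le> c') \<and> (b \<le> a \<longleftrightarrow> b' \<le> a) \<and> (a \<le> b \<longleftrightarrow> a \<le> b')"

lemma same_tripleI: "qftp [a, b, c] = qftp [a, b', c'] \<Longrightarrow> same_triple a b c b' c'"
  using qftp_inf_le[of "[a, b, c]" "[a, b', c']" 1 2 0] qftp_inf_le[of "[a, b, c]" "[a, b', c']" 0 2 1]
    qftp_inf_le[of "[a, b, c]" "[a, b', c']" 0 1 2] qftp_inf_le[of "[a, b, c]" "[a, b', c']" 1 1 2]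
    qftp_inf_le[of "[a, b, c]" "[a, b', c']" 1 1 0] qftp_inf_le[of "[a, b, c]" "[a, b', c']" 0 0 1]
  by (simp add: same_triple_def)

definition moves_meet :: "('a::semilattice_inf \<Rightarrow> 'a) \<Rightarrow> 'a \<Rightarrow> nat \<Rightarrow> bool" where
  "moves_meet \<sigma> x k \<longleftrightarrow> inf x ((\<sigma> ^^ k) x) \<noteq> inf ((\<sigma> ^^ k) x) ((\<sigma> ^^ (2 * k)) x)"

lemma meet_moved_graph_of: "meet_moved (graph_of \<sigma>) x k \<longleftrightarrow> moves_meet \<sigma> x k"
  by (simp add: meet_moved_def moves_meet_def graph_of_relpow)

section \<open>First consequences of PEC for a non-cyclic orbit\<close>

locale pec_orbit = universal_tree T for T :: "'a::semilattice_inf itself" +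
  fixes p :: "('a \<times> 'a) set" and \<xi> :: "'a list"
  assumes finite_p: "finite p" and partial_aut: "partial_automorphism p" and pec: "PEC p"
    and orbit: "orbit_of p \<xi>" and noncyclic: "\<not> cyclic \<xi>"
begin

definition n :: nat where "n = length \<xi> - 1"

definition start :: 'a where "start = \<xi> ! 0"

lemma length_orbit: "length \<xi> = Suc n" and n_pos: "0 < n"
  using orbit by (auto simp: orbit_of_def n_def)

lemma orbit_step: "i < n \<Longrightarrow> (\<xi> ! i, \<xi> ! Suc i) \<in> p"
  using orbit length_orbit by (simp add: orbit_of_def)

lemma start_notin_Range: "start \<notin> Range p" and last_notin_Domain: "\<xi> ! n \<notin> Domain p"
proof -
  have "\<xi> \<noteq> []" using length_orbit by auto
  then have "hd \<xi> = start" "last \<xi> = \<xi> ! n"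
    using length_orbit by (simp_all add: start_def last_conv_nth hd_conv_nth)
  then show "start \<notin> Range p" "\<xi> ! n \<notin> Domain p"
    using orbit noncyclic unfolding orbit_of_def by simp_all
qed

lemma nth_neq_start: "0 < i \<Longrightarrow> i \<le> n \<Longrightarrow> \<xi> ! i \<noteq> start"
proof
  assume "0 < i" "i \<le> n" "\<xi> ! i = start"
  then have "0 < i \<and> i < length \<xi> \<and> \<xi> ! 0 = \<xi> ! i" by (simp add: length_orbit start_def)
  then show False using noncyclic unfolding cyclic_def by blast
qed

lemma start_in_Domain: "start \<in> Domain p"
  using orbit_step[OF n_pos] by (auto simp: start_def)

lemma start_initial: "initial_point p start"
  using start_in_Domain start_notin_Range by (simp add: initial_point_def)

lemma single_valued_p: "single_valued p"
  using partial_aut by (simp add: partial_automorphism_def)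

lemma start_relpow_nth: "m \<le> n \<Longrightarrow> (start, \<xi> ! m) \<in> p ^^ m"
proof (induction m)
  case (Suc m)
  then have "(start, \<xi> ! m) \<in> p ^^ m" "(\<xi> ! m, \<xi> ! Suc m) \<in> p" using orbit_step by simp_all
  then show ?case by (rule relpow_Suc_I)
qed (simp add: start_def)

lemma start_relpow: "(start, y) \<in> p ^^ m \<Longrightarrow> m \<le> n"
proof (induction m arbitrary: y)
  case (Suc m)
  from Suc.prems obtain z where z: "(start, z) \<in> p ^^ m" "(z, y) \<in> p" by (rule relpow_Suc_E)
  have "m \<le> n" using Suc.IH[OF z(1)] .
  have "single_valued (p ^^ m)" by (rule single_valued_relpow[OF single_valued_p])
  then have "z = \<xi> ! m" using z(1) start_relpow_nth[OF \<open>m \<le> n\<close>] by (rule single_valuedD)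
  then have "m \<noteq> n" using z(2) last_notin_Domain by auto
  with \<open>m \<le> n\<close> show ?case by simp
qed simp

lemma extends_nth: "extends \<sigma> p \<Longrightarrow> m \<le> n \<Longrightarrow> (\<sigma> ^^ m) start = \<xi> ! m"
  using extends_relpow start_relpow_nth by blast

lemma extends_nth_Range: "extends \<sigma> p \<Longrightarrow> 0 < m \<Longrightarrow> m \<le> n \<Longrightarrow> (\<sigma> ^^ m) start \<in> Range p"
proof -
  assume ext: "extends \<sigma> p" and m: "0 < m" "m \<le> n"
  then obtain i where i: "m = Suc i" using gr0_implies_Suc by blast
  have "\<xi> ! Suc i \<in> Range p" using orbit_step[of i] m i by (intro RangeI) simp
  then show ?thesis using extends_nth[OF ext m(2)] i by simp
qed

text \<open>\<open>PEC\<close> for the graph of \<sigma> with \<mu> taken to be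
  \<open>start\<close>. The type is kept for the smaller exponent \<open>m'\<close>; the larger one
  serves to push \<open>m'\<close> down through the congruences.\<close>

lemma pec_realize:
  assumes ext: "extends \<sigma> p" and init: "initial_point p \<eta>" "initial_point p \<zeta>"
    and m: "n < m1" "0 < m2"
  obtains m' m'' j where "0 < m'" "m' < m''" "m'' \<le> n" "0 < j" "(\<zeta>, (\<sigma> ^^ j) \<zeta>) \<in> p ^^ j"
    and "same_triple \<eta> ((\<sigma> ^^ m1) start) ((\<sigma> ^^ m2) \<zeta>) ((\<sigma> ^^ m') start) ((\<sigma> ^^ j) \<zeta>)"
    and "\<exists>k. moves_meet \<sigma> start k \<Longrightarrow> [m1 = m'] (mod (LEAST k. moves_meet \<sigma> start k))"
    and "\<exists>k. moves_meet \<sigma> start k \<Longrightarrow> [m1 = m''] (mod (LEAST k. moves_meet \<sigma> start k))"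
proof -
  let ?b = "(\<sigma> ^^ m1) start" and ?c = "(\<sigma> ^^ m2) \<zeta>" and ?k = "LEAST k. moves_meet \<sigma> start k"
  note inst = spec[OF spec[OF spec[OF spec[OF spec[OF spec[OF spec[OF spec[OF pec[unfolded PEC_def],
    of "graph_of \<sigma>"], of \<eta>], of start], of \<zeta>], of m1], of m2], of ?b], of ?c]
  have prems: "p \<subseteq> graph_of \<sigma>" "partial_automorphism (graph_of \<sigma>)" "0 < m1"
      "(start, ?b) \<in> graph_of \<sigma> ^^ m1" "(\<zeta>, ?c) \<in> graph_of \<sigma> ^^ m2"
    using ext m by (simp_all add: extends_def graph_of_relpow partial_automorphism_graph_of)
  note pre = mp[OF mp[OF mp[OF mp[OF mp[OF mp[OF mp[OF mp[OF mp[OF inst prems(1)] prems(2)] init(1)]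
    start_initial] init(2)] prems(3)] m(2)] prems(4)] prems(5), unfolded meet_moved_graph_of]
  obtain m1' m2' m1'' m2'' b' c' b'' c'' where
    pos: "0 < m1'" "0 < m2'" "0 < m1''" "0 < m2''"
    and neq: "start \<notin> Domain (p ^^ m1) \<longrightarrow> m1' \<noteq> m1''"
    and rel: "(start, b') \<in> p ^^ m1'" "(\<zeta>, c') \<in> p ^^ m2'" "(start, b'') \<in> p ^^ m1''" "(\<zeta>, c'') \<in> p ^^ m2''"
    and types: "qftp [\<eta>, ?b, ?c] = qftp [\<eta>, b', c']" "qftp [\<eta>, ?b, ?c] = qftp [\<eta>, b'', c'']"
    and cong: "(\<exists>k. moves_meet \<sigma> start k) \<longrightarrow> [m1 = m1'] (mod ?k) \<and> [m1' = m1''] (mod ?k)"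
    using pre by (elim exE conjE)
  \<comment> \<open>Because \<open>m1\<close> exceeds \<open>n\<close>, clause (a) of PEC yields two
    different exponents.\<close>
  have "start \<notin> Domain (p ^^ m1)" using start_relpow m(1) by fastforce
  with neq have "m1' \<noteq> m1''" by blast
  have eqs: "b' = (\<sigma> ^^ m1') start" "c' = (\<sigma> ^^ m2') \<zeta>" "b'' = (\<sigma> ^^ m1'') start" "c'' = (\<sigma> ^^ m2'') \<zeta>"
    using rel extends_relpow[OF ext] by simp_all
  have cong': "[m1 = m1'] (mod ?k)" "[m1 = m1''] (mod ?k)" if "\<exists>k. moves_meet \<sigma> start k"
    using cong that cong_trans by blast+
  have le: "m1' \<le> n" "m1'' \<le> n" using rel start_relpow by blast+
  note same = same_tripleI[OF types(1), unfolded eqs] same_tripleI[OF types(2), unfolded eqs]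
  show thesis
  proof (cases "m1' < m1''")
    case True
    show thesis
      by (rule that[OF pos(1) True le(2) pos(2) _ same(1) cong'(1) cong'(2)])
        (use rel(2) in \<open>simp_all add: eqs\<close>)
  next
    case False
    with \<open>m1' \<noteq> m1''\<close> have "m1'' < m1'" by simp
    show thesis
      by (rule that[OF pos(3) \<open>m1'' < m1'\<close> le(1) pos(4) _ same(2) cong'(2) cong'(1)])
        (use rel(4) in \<open>simp_all add: eqs\<close>)
  qed
qed

text \<open>A return to \<open>start\<close> after time \<open>n\<close> would be copied by PEC to a
  return at some time below \<open>n\<close>, which is impossible in a non-cyclic orbit.\<close>

lemma extends_not_periodic:
  assumes ext: "extends \<sigma> p" and "0 < m"
  shows "(\<sigma> ^^ m) start \<noteq> start"
proof
  assume eq: "(\<sigma> ^^ m) start = start"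
  show False
  proof (cases "m \<le> n")
    case True
    then show False using extends_nth[OF ext True] nth_neq_start[OF assms(2) True] eq by simp
  next
    case False
    then have "n < m" by simp
    from pec_realize[OF ext start_initial start_initial this zero_less_one]
    obtain m' m'' j where *: "0 < m'" "m' < m''" "m'' \<le> n"
        "same_triple start ((\<sigma> ^^ m) start) ((\<sigma> ^^ 1) start) ((\<sigma> ^^ m') start) ((\<sigma> ^^ j) start)" .
    then have "(\<sigma> ^^ m') start = start" unfolding same_triple_def eq by (simp add: order.antisym)
    then show False using extends_nth[OF ext, of m'] nth_neq_start[of m'] * by simp
  qed
qed

lemma moves_meet_pos: "moves_meet \<sigma> x k \<Longrightarrow> 0 < k"
  by (cases k) (simp_all add: moves_meet_def)

text \<open>With \<open>k\<close> the least moved exponent, \<open>0 < m' < m'' < Suc n\<close> are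
  congruent modulo \<open>k\<close>, so the last three are at least \<open>k\<close> apart.\<close>

lemma least_moves_meet:
  assumes ext: "extends \<sigma> p" and "moves_meet \<sigma> start l"
  shows "2 * (LEAST k. moves_meet \<sigma> start k) \<le> n"
proof -
  let ?k = "LEAST k. moves_meet \<sigma> start k"
  have ex: "\<exists>k. moves_meet \<sigma> start k" using assms(2) ..
  from pec_realize[OF ext start_initial start_initial lessI[of n] zero_less_one]
  obtain m' m'' where *: "0 < m'" "m' < m''" "m'' \<le> n"
      "[Suc n = m'] (mod ?k)" "[Suc n = m''] (mod ?k)" using ex by blast
  then have "[m'' = m'] (mod ?k)" using cong_sym cong_trans by blast
  then have "?k dvd m'' - m'" using *(2) by (simp add: cong_altdef_nat)
  moreover have "?k dvd Suc n - m''" using *(3,5) by (simp add: cong_altdef_nat)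
  ultimately have "?k \<le> m'' - m'" "?k \<le> Suc n - m''"
    using *(2,3) by (auto intro: dvd_imp_le)
  then show ?thesis using *(1-3) by linarith
qed

text \<open>The meets in question involve only points of \<xi>, on which all extensions
  agree.\<close>

lemma moves_meet_visible:
  assumes "extends \<sigma> p" "extends \<tau> p" and "2 * k \<le> n"
  shows "moves_meet \<sigma> start k \<longleftrightarrow> moves_meet \<tau> start k"
  using assms by (simp add: moves_meet_def extends_nth)

lemma moves_meet_transfer:
  assumes "extends \<sigma> p" "extends \<tau> p" and "moves_meet \<sigma> start k"
  shows "\<exists>k. moves_meet \<tau> start k"
  using moves_meet_visible[OF assms(1,2) least_moves_meet[OF assms(1,3)]] LeastI[of "moves_meet \<sigma> start", OF assms(3)]
  by blast

end

section \<open>Every non-cyclic orbit moves a meet\<close>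

text \<open>No \<open>s\<close> can share a branch above \<open>d\<close> with two different
  \<open>A i\<close> and \<open>A j\<close>: both meets with \<open>s\<close> are comparable, and
  the smaller one lies below \<open>inf (A i) (A j)\<close>. Finitely many \<open>s\<close> thus
  spoil only finitely many indices.\<close>

lemma (in universal_tree) pigeonhole_cones:
  fixes S :: "'a set" and A :: "nat \<Rightarrow> 'a" and d :: 'a
  assumes "finite S" and "\<And>i j. i < j \<Longrightarrow> inf (A i) (A j) \<le> d"
  shows "\<exists>i. \<forall>s\<in>S. inf s (A i) \<le> d"
proof (rule ccontr)
  assume "\<not> ?thesis"
  then have "\<forall>i. \<exists>s. s \<in> S \<and> \<not> inf s (A i) \<le> d" by blast
  from choice[OF this] obtain f where f: "\<And>i. f i \<in> S" "\<And>i. \<not> inf (f i) (A i) \<le> d" by blast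
  have neq: "f i \<noteq> f j" if "i < j" for i j
  proof
    assume eq: "f i = f j"
    have "inf (f i) (A i) \<le> inf (f i) (A j) \<or> inf (f i) (A j) \<le> inf (f i) (A i)"
      by (rule below_linear[OF inf.cobounded1 inf.cobounded1])
    then have "inf (f i) (A i) \<le> inf (A i) (A j) \<or> inf (f i) (A j) \<le> inf (A i) (A j)"
      by auto
    then show False
      using order.trans[OF _ assms(2)[OF that]] f(2)[of i] f(2)[of j] unfolding eq by auto
  qed
  have "inj f"
  proof (rule injI)
    fix i j assume "f i = f j"
    then show "i = j" using neq[of i j] neq[of j i] by (cases i j rule: linorder_cases) simp_all
  qed
  moreover have "finite (range f)" by (rule finite_subset[OF _ assms(1)]) (use f(1) in auto)
  ultimately show False using finite_imageD[of f UNIV] by simp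
qed

lemma not_moves_meet_fixed:
  assumes "automorphism \<sigma>" and "\<not> moves_meet \<sigma> x l"
  shows "(\<sigma> ^^ l) (inf x ((\<sigma> ^^ l) x)) = inf x ((\<sigma> ^^ l) x)"
proof -
  have "(\<sigma> ^^ l) (inf x ((\<sigma> ^^ l) x)) = inf ((\<sigma> ^^ l) x) ((\<sigma> ^^ (2 * l)) x)"
    by (simp add: automorphism_inf[OF automorphism_funpow[OF assms(1)]] funpow_add_apply mult_2)
  then show ?thesis using assms(2) by (simp only: moves_meet_def not_not)
qed

context pec_orbit
begin

text \<open>
  Otherwise the meet \<open>d\<close> lies in a gap of the finite meet-tree generated by \<open>p\<close>. Composing \<open>\<sigma>\<close> with
  an automorphism that moves \<open>d\<close> inside this gap, but fixes its other iterates, moves the meet.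
\<close>

lemma unmoved_meets_bounded:
  assumes ext: "extends \<sigma> p" and unmoved: "\<And>\<tau> l. extends \<tau> p \<Longrightarrow> \<not> moves_meet \<tau> start l"
    and "0 < t"
  shows "\<exists>a\<in>Field p. \<exists>b\<in>Field p. inf start ((\<sigma> ^^ t) start) = inf a b"
proof (rule ccontr)
  assume contr: "\<not> ?thesis"
  define X where "X i = (\<sigma> ^^ i) start" for i
  define d where "d = inf start (X t)"
  have aut: "automorphism (\<sigma> ^^ i)" for i
    by (rule automorphism_funpow[OF extends_automorphism[OF ext]])
  have inf_fixed: "(\<sigma> ^^ l) (inf start (X l)) = inf start (X l)" for l
    unfolding X_def by (rule not_moves_meet_fixed[OF extends_automorphism[OF ext] unmoved[OF ext]])
  have fix_t: "(\<sigma> ^^ t) d = d" using inf_fixed by (simp add: d_def)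
  have le_X: "(\<sigma> ^^ i) d \<le> X i" for i
    using automorphism_le[OF aut, of i d start] by (simp add: d_def X_def)
  \<comment> \<open>The first positive time at which the orbit of \<open>start\<close> is above
    \<open>d\<close>. It turns out that \<open>d\<close> is fixed by \<open>\<sigma> ^^ r\<close>
    and that \<open>t\<close> may be replaced by \<open>r\<close>.\<close>
  define r where "r = (LEAST i. 0 < i \<and> d \<le> X i)"
  have r_ex: "0 < t \<and> d \<le> X t" using assms(3) by (simp add: d_def)
  have r: "0 < r" "d \<le> X r" using LeastI[of "\<lambda>i. 0 < i \<and> d \<le> X i", OF r_ex] by (simp_all add: r_def)
  have r_least: "\<not> d \<le> X i" if "0 < i" "i < r" for i
    using not_less_Least[of i "\<lambda>i. 0 < i \<and> d \<le> X i"] that by (simp add: r_def)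
  \<comment> \<open>Every iterate \<open>\<sigma> ^^ i\<close> has \<open>d\<close> as a periodic
    point, since its \<open>t\<close>-th power fixes \<open>d\<close>.\<close>
  have comparable_fixed: "(\<sigma> ^^ i) d = d" if "d \<le> (\<sigma> ^^ i) d \<or> (\<sigma> ^^ i) d \<le> d" for i
  proof (rule automorphism_comparable_fixed[OF aut _ assms(3) that])
    have "((\<sigma> ^^ i) ^^ t) d = (\<sigma> ^^ (t * i)) d" by (simp add: funpow_mult mult.commute)
    then show "((\<sigma> ^^ i) ^^ t) d = d" using funpow_fixed_mult[OF fix_t] by simp
  qed
  have fix_r: "(\<sigma> ^^ r) d = d"
    by (rule comparable_fixed[OF below_linear[OF r(2) le_X]])
  have t_mod: "t mod r = 0"
  proof (rule ccontr)
    assume "t mod r \<noteq> 0"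
    have "t = t mod r + r * (t div r)" by simp
    then have "(\<sigma> ^^ t) d = (\<sigma> ^^ (t mod r)) ((\<sigma> ^^ (r * (t div r))) d)"
      by (simp only: funpow_add_apply)
    also have "(\<sigma> ^^ (r * (t div r))) d = d" by (rule funpow_fixed_mult[OF fix_r])
    finally have "d \<le> X (t mod r)" using le_X[of "t mod r"] fix_t by simp
    then show False using r_least[of "t mod r"] \<open>t mod r \<noteq> 0\<close> r(1) by simp
  qed
  have d_eq: "d = inf start (X r)"
  proof (rule order.antisym)
    show "d \<le> inf start (X r)" using r(2) by (simp add: d_def)
    let ?e = "inf start (X r)"
    have "(\<sigma> ^^ (r * (t div r))) ?e = ?e" by (rule funpow_fixed_mult[OF inf_fixed])
    moreover have "r * (t div r) = t" using t_mod by auto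
    ultimately have "(\<sigma> ^^ t) ?e = ?e" by simp
    moreover have "(\<sigma> ^^ t) ?e \<le> X t"
      using automorphism_le[OF aut, of t ?e start] by (simp add: X_def)
    ultimately show "?e \<le> d" by (simp add: d_def)
  qed
  \<comment> \<open>The intermediate iterates of \<open>start\<close> and \<open>d\<close> are
    included so that \<theta> cannot act on either trajectory before time \<open>r\<close>. By
    choice of \<open>r\<close>, none of the added points is above \<open>d\<close>.\<close>
  define F where "F = Field p \<union> X ` {0<..<r} \<union> (\<lambda>i. (\<sigma> ^^ i) d) ` {0<..<r}"
  have "finite F" using finite_p by (simp add: F_def finite_Field)
  have "start \<in> F" using start_in_Domain by (simp add: F_def Field_def)
  have above: "y \<in> Field p" if "y \<in> F" "d \<le> y" for y
  proof (rule ccontr)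
    assume "y \<notin> Field p"
    then consider i where "0 < i" "i < r" "y = X i" | i where "0 < i" "i < r" "y = (\<sigma> ^^ i) d"
      using \<open>y \<in> F\<close> by (auto simp: F_def)
    then show False
    proof cases
      case 1
      then show False using r_least that(2) by simp
    next
      case 2
      then have "(\<sigma> ^^ i) d = d" using comparable_fixed that(2) by simp
      then show False using r_least[OF 2(1,2)] le_X[of i] by simp
    qed
  qed
  have "d \<noteq> inf a b" if "a \<in> F" "b \<in> F" for a b
  proof
    assume "d = inf a b"
    then have "a \<in> Field p" "b \<in> Field p" using above that by simp_all
    then show False using contr \<open>d = inf a b\<close> by (auto simp: d_def X_def)
  qed
  from move_in_gap[OF \<open>finite F\<close> \<open>start \<in> F\<close> _ this]
  obtain \<theta> where \<theta>: "automorphism \<theta>" "\<forall>y\<in>F. \<theta> y = y" "\<theta> d \<noteq> d"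
    by (auto simp: d_def)
  let ?\<tau> = "\<theta> \<circ> \<sigma>"
  have ext': "extends ?\<tau> p"
    by (rule extends_comp[OF ext \<theta>(1)]) (use \<theta>(2) in \<open>simp add: F_def Field_def\<close>)
  have aut': "automorphism (?\<tau> ^^ r)"
    by (rule automorphism_funpow[OF extends_automorphism[OF ext']])
  have "(?\<tau> ^^ r) start = \<theta> ((\<sigma> ^^ r) start)"
    by (rule funpow_comp_fixing_last[OF _ r(1)]) (use \<theta>(2) in \<open>simp add: F_def X_def\<close>)
  then have start_r: "(?\<tau> ^^ r) start = \<theta> (X r)" by (simp add: X_def)
  have d_r: "(?\<tau> ^^ r) d = \<theta> d"
    using funpow_comp_fixing_last[of r \<theta> \<sigma> d] r(1) \<theta>(2) fix_r by (simp add: F_def)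
  have meet: "inf start ((?\<tau> ^^ r) start) = \<theta> d"
    using \<theta>(2) \<open>start \<in> F\<close> unfolding start_r d_eq by (simp add: automorphism_inf[OF \<theta>(1)])
  have "inf ((?\<tau> ^^ r) start) ((?\<tau> ^^ (2 * r)) start) = (?\<tau> ^^ r) (inf start ((?\<tau> ^^ r) start))"
    by (simp add: automorphism_inf[OF aut'] funpow_add_apply mult_2)
  also have "\<dots> = (?\<tau> ^^ r) (\<theta> d)" by (simp only: meet)
  also have "\<dots> \<noteq> (?\<tau> ^^ r) d" using \<theta>(3) by (simp only: automorphism_inj[OF aut'] simp_thms)
  finally have "moves_meet ?\<tau> start r" by (simp only: moves_meet_def meet d_r)
  then show False using unmoved[OF ext'] by blast
qed

text \<open>
  Otherwise there is a largest meet \<open>e = \<xi>\<^sub>0 \<and> \<xi>\<^sub>t\<close>, and the iterates of \<open>\<xi>\<^sub>0\<close> under \<open>\<sigma>\<^sup>t\<close>, forward and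
  backward, lie in distinct cones above \<open>e\<close>. A forward iterate \<open>z\<close> and a backward iterate \<open>y\<close> whose
  cones avoid the range of \<open>p\<close> can be identified, which makes the orbit cyclic.
\<close>

lemma not_unmoved:
  assumes ext: "extends \<sigma> p"
  shows "\<exists>l. moves_meet \<sigma> start l"
proof (rule ccontr)
  assume "\<not> ?thesis"
  \<comment> \<open>A moved meet of another extension would be visible in \<xi> and hence moved by
    \<sigma> too.\<close>
  then have unmoved: "\<not> moves_meet \<tau> start l" if "extends \<tau> p" for \<tau> l
    using moves_meet_transfer[OF that ext] by blast
  define d where "d l = inf start ((\<sigma> ^^ l) start)" for l
  have aut: "automorphism (\<sigma> ^^ i)" for i
    by (rule automorphism_funpow[OF extends_automorphism[OF ext]])
  have d_fixed: "(\<sigma> ^^ l) (d l) = d l" for l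
    unfolding d_def by (rule not_moves_meet_fixed[OF extends_automorphism[OF ext] unmoved[OF ext]])
  have "d ` {0<..} \<subseteq> (\<lambda>(a, b). inf a b) ` (Field p \<times> Field p)"
  proof (rule image_subsetI)
    fix l :: nat assume "l \<in> {0<..}"
    then obtain a b where "a \<in> Field p" "b \<in> Field p" "d l = inf a b"
      using unmoved_meets_bounded[OF ext unmoved, of l] unfolding d_def by auto
    then show "d l \<in> (\<lambda>(a, b). inf a b) ` (Field p \<times> Field p)"
      by (intro image_eqI[of _ _ "(a, b)"]) simp_all
  qed
  then have fin: "finite (d ` {0<..})"
    by (rule finite_subset) (simp add: finite_Field finite_p)
  have "d ` {0<..} \<noteq> {}" by auto
  \<comment> \<open>All the meets \<open>d l\<close> lie below \<open>start\<close> and so form a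
    chain; hence the maximal one is the largest.\<close>
  from finite_has_maximal[OF fin this] obtain e where e: "e \<in> d ` {0<..}" "\<forall>y\<in>d ` {0<..}. e \<le> y \<longrightarrow> e = y" ..
  from e(1) obtain t where t: "0 < t" "e = d t" by auto
  have d_le: "d l \<le> e" if "0 < l" for l
  proof -
    have mem: "d l \<in> d ` {0<..}" using that by simp
    have "d l \<le> e \<or> e \<le> d l" by (rule below_linear[of _ start]) (simp_all add: t(2) d_def)
    then show ?thesis using bspec[OF e(2) mem] by auto
  qed
  have e_fixed: "(\<sigma> ^^ (t * q)) e = e" for q
    unfolding t(2) by (rule funpow_fixed_mult[OF d_fixed])
  have e_le_start: "e \<le> start" by (simp add: t(2) d_def)
  have meet_le: "inf ((\<sigma> ^^ (t * i)) start) ((\<sigma> ^^ (t * j)) start) \<le> e" if "i < j" for i j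
  proof -
    have tj: "t * i + t * (j - i) = t * j"
      using that by (simp add: add_mult_distrib2[symmetric])
    have "inf ((\<sigma> ^^ (t * i)) start) ((\<sigma> ^^ (t * j)) start) = (\<sigma> ^^ (t * i)) (d (t * (j - i)))"
      unfolding d_def automorphism_inf[OF aut] funpow_add_apply tj ..
    also have "\<dots> \<le> (\<sigma> ^^ (t * i)) e"
      unfolding automorphism_le[OF aut] by (rule d_le) (use that t(1) in simp)
    finally show ?thesis by (simp only: e_fixed)
  qed
  have finR: "finite (Range p)" using finite_p by (simp add: finite_Range)
  \<comment> \<open>\<open>Suc i\<close> keeps the exponent positive, so that \<open>start\<close>
    lies strictly between \<open>y\<close> and \<open>z\<close> on the trajectory built
    below.\<close>
  have "\<exists>i. \<forall>s\<in>Range p. inf s ((\<sigma> ^^ (t * Suc i)) start) \<le> e"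
    by (rule pigeonhole_cones[OF finR]) (rule meet_le, simp)
  then obtain a where a: "\<forall>s\<in>Range p. inf s ((\<sigma> ^^ (t * Suc a)) start) \<le> e" by blast
  define g where "g = inv \<sigma>"
  have aut_g: "automorphism (g ^^ i)" for i
    unfolding g_def by (rule automorphism_funpow[OF automorphism_inv[OF extends_automorphism[OF ext]]])
  have bij: "bij \<sigma>" using extends_automorphism[OF ext] by (simp add: automorphism_def)
  have \<sigma>_g: "(\<sigma> ^^ i) ((g ^^ i) y) = y" for i y unfolding g_def by (rule funpow_inv_cancel[OF bij])
  have g_eqI: "(g ^^ i) y = z" if "(\<sigma> ^^ i) z = y" for i y z
    using \<sigma>_g[of i y] that automorphism_inj[OF aut, of i "(g ^^ i) y" z] by simp
  have comm: "(f ^^ i) ((f ^^ j) w) = (f ^^ j) ((f ^^ i) w)" for f :: "'a \<Rightarrow> 'a" and i j w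
    by (simp add: funpow_add_apply add.commute)
  have g_fixed: "(g ^^ (t * q)) e = e" for q by (rule g_eqI[OF e_fixed])
  have "\<exists>i. \<forall>s\<in>Range p. inf s ((g ^^ (t * i)) start) \<le> e"
  proof (rule pigeonhole_cones[OF finR])
    fix i j :: nat assume "i < j"
    have tj: "t * (j - i) + t * i = t * j"
      using \<open>i < j\<close> by (simp add: add_mult_distrib2[symmetric])
    have "(g ^^ (t * j)) ((\<sigma> ^^ (t * (j - i))) start) = (g ^^ (t * i)) start"
      by (rule g_eqI) (simp only: tj[symmetric] funpow_add_apply[symmetric] \<sigma>_g)
    then have "inf ((g ^^ (t * i)) start) ((g ^^ (t * j)) start) = (g ^^ (t * j)) (d (t * (j - i)))"
      unfolding d_def automorphism_inf[OF aut_g] by (simp only: inf.commute)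
    also have "\<dots> \<le> (g ^^ (t * j)) e"
      unfolding automorphism_le[OF aut_g] by (rule d_le) (use \<open>i < j\<close> t(1) in simp)
    finally show "inf ((g ^^ (t * i)) start) ((g ^^ (t * j)) start) \<le> e" by (simp only: g_fixed)
  qed
  then obtain b where b: "\<forall>s\<in>Range p. inf s ((g ^^ (t * b)) start) \<le> e" by blast
  define y where "y = (g ^^ (t * b)) start"
  define M where "M = t * (Suc a + b)"
  define z where "z = (\<sigma> ^^ M) y"
  have M: "M = t * Suc a + t * b" by (simp add: M_def algebra_simps)
  have \<sigma>_y: "(\<sigma> ^^ (t * b)) y = start" by (simp add: y_def \<sigma>_g)
  have z_eq: "z = (\<sigma> ^^ (t * Suc a)) start"
    unfolding z_def M funpow_add_apply[symmetric] \<sigma>_y ..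
  have M_pos: "0 < M" "t * b < M" using t(1) by (simp_all add: M)
  \<comment> \<open>The facts about the meets \<open>d l\<close> at \<open>start\<close>, pulled
    back to \<open>y\<close> by the inverse iterate, which fixes \<open>e\<close>.\<close>
  have y_meet: "inf y ((\<sigma> ^^ l) y) \<le> e \<and> (\<sigma> ^^ l) (inf y ((\<sigma> ^^ l) y)) = inf y ((\<sigma> ^^ l) y)" if "0 < l" for l
  proof -
    have "(g ^^ (t * b)) ((\<sigma> ^^ l) start) = (\<sigma> ^^ l) y"
      by (rule g_eqI, subst comm) (simp only: \<sigma>_y)
    then have eq: "inf y ((\<sigma> ^^ l) y) = (g ^^ (t * b)) (d l)"
      unfolding d_def automorphism_inf[OF aut_g] y_def by simp
    have "(g ^^ (t * b)) (d l) \<le> (g ^^ (t * b)) e" unfolding automorphism_le[OF aut_g] by (rule d_le[OF that])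
    moreover have "(\<sigma> ^^ l) ((g ^^ (t * b)) (d l)) = (g ^^ (t * b)) (d l)"
      by (rule sym, rule g_eqI, subst comm) (simp only: \<sigma>_g d_fixed)
    ultimately show ?thesis unfolding eq g_fixed by simp
  qed
  define F where "F = Range p \<union> (\<lambda>i. (\<sigma> ^^ i) y) ` {0<..<M}"
  have finF: "finite F" using finR by (simp add: F_def)
  have F_y: "inf f y \<le> e" and F_z: "inf f z \<le> e" if f: "f \<in> F" for f
  proof -
    have "inf f y \<le> e \<and> inf f z \<le> e"
    proof (cases "f \<in> Range p")
      case True
      then show ?thesis using a b by (simp add: y_def z_eq)
    next
      case False
      then obtain i where i: "0 < i" "i < M" "f = (\<sigma> ^^ i) y" using f by (auto simp: F_def)
      have "inf f y \<le> e" using y_meet[OF i(1)] i(3) by (simp add: inf.commute)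
      moreover have "inf f z \<le> e"
      proof -
        \<comment> \<open>Writing \<open>z\<close> as the iterate of \<open>f\<close> after
          \<open>M - i\<close> further steps reduces the meet of \<open>f\<close> and
          \<open>z\<close> to a meet at \<open>y\<close>.\<close>
        let ?l = "M - i" and ?m = "inf y ((\<sigma> ^^ (M - i)) y)"
        have l: "0 < ?l" "i + ?l = M" using i by simp_all
        have "inf f z = (\<sigma> ^^ i) ?m"
          unfolding i(3) z_def automorphism_inf[OF aut] funpow_add_apply l(2) ..
        also have "\<dots> = (\<sigma> ^^ i) ((\<sigma> ^^ ?l) ?m)" using y_meet[OF l(1)] by simp
        also have "\<dots> = (\<sigma> ^^ M) ?m" by (simp only: funpow_add_apply l(2))
        also have "\<dots> \<le> (\<sigma> ^^ M) e" unfolding automorphism_le[OF aut] using y_meet[OF l(1)] ..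
        also have "\<dots> = e" unfolding M_def by (rule e_fixed)
        finally show ?thesis .
      qed
      ultimately show ?thesis ..
    qed
    then show "inf f y \<le> e" "inf f z \<le> e" by simp_all
  qed
  have e_y: "e \<le> y"
    using automorphism_le[OF aut_g, of "t * b" e start] e_le_start by (simp add: y_def g_fixed)
  have e_z: "e \<le> z"
    using automorphism_le[OF aut, of M e y] e_y e_fixed[of "Suc a + b"] by (simp add: z_def M_def)
  have start_neq: "start \<noteq> e"
  proof
    assume "start = e"
    then have "(\<sigma> ^^ (t * 1)) start = start" using e_fixed[of 1] by simp
    then show False using extends_not_periodic[OF ext, of "t * 1"] t(1) by simp
  qed
  have y_neq: "y \<noteq> e" using \<sigma>_y start_neq e_fixed[of b] by auto
  have z_neq: "z \<noteq> e"
    using y_neq automorphism_inj[OF aut, of M y e] e_fixed[of "Suc a + b"] by (simp add: z_def M_def)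
  have inf_e: "inf h f = inf e f" if "inf f h \<le> e" "e \<le> h" for h f
  proof (rule order.antisym)
    show "inf h f \<le> inf e f" using that(1) by (simp add: inf.commute)
    show "inf e f \<le> inf h f" using that(2) by (simp add: le_infI1)
  qed
  have not_le: "\<not> h \<le> f" if "inf f h \<le> e" "e \<le> h" "h \<noteq> e" for h f
  proof
    assume "h \<le> f"
    then have "inf f h = h" by (rule inf.absorb2)
    with that show False by simp
  qed
  \<comment> \<open>Both \<open>y\<close> and \<open>z\<close> lie strictly above \<open>e\<close>
    in cones that contain no point of \<open>F\<close>, so they have the same position over
    \<open>F\<close>.\<close>
  have "\<exists>\<theta>. automorphism \<theta> \<and> (\<forall>f\<in>F. \<theta> f = f) \<and> \<theta> z = y"
  proof (rule extend_point[OF finF])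
    fix f assume f: "f \<in> F"
    show "z \<le> f \<longleftrightarrow> y \<le> f"
      using not_le[OF F_z[OF f] e_z z_neq] not_le[OF F_y[OF f] e_y y_neq] by simp
    fix f' assume f': "f' \<in> F"
    show "inf z f \<le> f' \<longleftrightarrow> inf y f \<le> f'"
      unfolding inf_e[OF F_z[OF f] e_z] inf_e[OF F_y[OF f] e_y] ..
    have "inf f f' \<le> h \<longleftrightarrow> inf f f' \<le> e" if "inf f h \<le> e" "e \<le> h" for h
    proof
      assume "inf f f' \<le> h"
      then have "inf f f' \<le> inf f h" by simp
      also note that(1)
      finally show "inf f f' \<le> e" .
    qed (rule order.trans[OF _ that(2)])
    from this[OF F_z[OF f] e_z] this[OF F_y[OF f] e_y]
    show "inf f f' \<le> z \<longleftrightarrow> inf f f' \<le> y" by simp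
  qed
  then obtain \<theta> where \<theta>: "automorphism \<theta>" "\<forall>f\<in>F. \<theta> f = f" "\<theta> z = y" by blast
  let ?\<tau> = "\<theta> \<circ> \<sigma>"
  have ext': "extends ?\<tau> p"
    by (rule extends_comp[OF ext \<theta>(1)]) (use \<theta>(2) in \<open>simp add: F_def\<close>)
  have fixing: "\<theta> ((\<sigma> ^^ i) y) = (\<sigma> ^^ i) y" if "0 < i" "i < M" for i
    using \<theta>(2) that by (simp add: F_def)
  \<comment> \<open>The trajectory from \<open>y\<close> follows \<sigma> up to time
    \<open>M\<close>, when \<theta> sends \<open>z\<close> back to \<open>y\<close>; it passes
    through \<open>start\<close> on the way, so \<open>start\<close> becomes periodic.\<close>
  have "(?\<tau> ^^ M) y = y"
    using funpow_comp_fixing_last[OF fixing M_pos(1)] \<theta>(3) by (simp add: z_def)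
  moreover have to_start: "(?\<tau> ^^ (t * b)) y = start"
    using funpow_comp_fixing[OF fixing M_pos(2)] \<sigma>_y by simp
  ultimately have "(?\<tau> ^^ M) start = start"
    using comm[of M ?\<tau> "t * b" y] by (simp only:)
  then show False using extends_not_periodic[OF ext' M_pos(1)] by simp
qed

end

section \<open>The position of the next point of an orbit\<close>

text \<open>In this setting \<open>X (Suc n)\<close> will be the value of \<sigma> at the last point
  of \<xi>, whose position is to be determined.\<close>

locale pec_extension = pec_orbit T p \<xi>
  for T :: "'a::semilattice_inf itself" and p :: "('a \<times> 'a) set" and \<xi> :: "'a list" +
  fixes \<sigma> :: "'a \<Rightarrow> 'a"
  assumes ext: "extends \<sigma> p"
begin

definition k :: nat where "k = (LEAST k. moves_meet \<sigma> start k)"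

lemma moves_meet_k: "moves_meet \<sigma> start k"
  unfolding k_def using not_unmoved[OF ext] by (rule LeastI_ex)

lemma two_k_le: "2 * k \<le> n"
  unfolding k_def by (rule least_moves_meet[OF ext moves_meet_k])

sublocale spiral T \<sigma> start k
proof
  show "automorphism \<sigma>" by (rule extends_automorphism[OF ext])
  show "0 < k" by (rule moves_meet_pos[OF moves_meet_k])
  show "inf start ((\<sigma> ^^ k) start) \<noteq> inf ((\<sigma> ^^ k) start) ((\<sigma> ^^ (2 * k)) start)"
    using moves_meet_k unfolding moves_meet_def .
  fix l assume "l < k"
  then have "\<not> moves_meet \<sigma> start l" unfolding k_def by (rule not_less_Least)
  then show "inf start ((\<sigma> ^^ l) start) = inf ((\<sigma> ^^ l) start) ((\<sigma> ^^ (2 * l)) start)"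
    by (simp only: moves_meet_def not_not)
qed

text \<open>In the residue class of \<open>Suc n\<close>, \<open>c a\<close> is the last meet
  between points of \<xi>, as \<open>a + k = b \<le> n\<close>. The next one, \<open>c b\<close>,
  already involves the new point \<open>X (Suc n)\<close>.\<close>

definition a :: nat where "a = Suc n - 2 * k"

definition b :: nat where "b = Suc n - k"

lemma a_add: "a + k = b" and b_add: "b + k = Suc n"
  using two_k_le by (simp_all add: a_def b_def)

lemma b_cong: "[b = Suc n] (mod k)"
  unfolding b_add[symmetric] by (simp add: cong_def)

lemma a_cong: "[a = b] (mod k)"
  unfolding a_add[symmetric] by (simp add: cong_def)

lemma cong_less_add_le:
  assumes "[i = j] (mod k)" and "i < j"
  shows "i + k \<le> j"
proof -
  from cong_le_obtain[OF assms] obtain s where "0 < s" "j = i + s * k" .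
  then show ?thesis by (cases s) simp_all
qed

text \<open>The two exponents from PEC are below \<open>Suc n\<close> and in its class, so the
  smaller is at most \<open>Suc n - 2 * k\<close>.\<close>

lemma realize:
  assumes "initial_point p \<eta>" "initial_point p \<zeta>" and "n < m1" "[m1 = Suc n] (mod k)" "0 < m2"
  obtains m j where "[m = b] (mod k)" "m \<le> a" "0 < j" "(\<zeta>, (\<sigma> ^^ j) \<zeta>) \<in> p ^^ j"
    "same_triple \<eta> (X m1) ((\<sigma> ^^ m2) \<zeta>) (X m) ((\<sigma> ^^ j) \<zeta>)"
proof -
  from pec_realize[OF ext assms(1,2,3,5)] obtain m m'' j where
    *: "0 < m" "m < m''" "m'' \<le> n" "0 < j" "(\<zeta>, (\<sigma> ^^ j) \<zeta>) \<in> p ^^ j"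
      "same_triple \<eta> ((\<sigma> ^^ m1) start) ((\<sigma> ^^ m2) \<zeta>) ((\<sigma> ^^ m) start) ((\<sigma> ^^ j) \<zeta>)"
    and cong: "\<exists>k. moves_meet \<sigma> start k \<Longrightarrow> [m1 = m] (mod k)" "\<exists>k. moves_meet \<sigma> start k \<Longrightarrow> [m1 = m''] (mod k)"
    unfolding k_def by blast
  have ex: "\<exists>k. moves_meet \<sigma> start k" using moves_meet_k ..
  have c1: "[m'' = Suc n] (mod k)" "[m = m''] (mod k)"
    using cong_trans[OF cong_sym[OF cong(2)[OF ex]] assms(4)]
      cong_trans[OF cong_sym[OF cong(1)[OF ex]] cong(2)[OF ex]] .
  have "m + k \<le> m''" "m'' + k \<le> Suc n"
    using cong_less_add_le[OF c1(2) *(2)] cong_less_add_le[OF c1(1)] *(3) by simp_all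
  then have "m \<le> a" by (simp add: a_def)
  moreover have "[m = b] (mod k)" using cong_trans[OF cong_trans[OF c1(2) c1(1)] cong_sym[OF b_cong]] .
  ultimately show thesis using that *(4-6) by (simp add: X_def)
qed

section \<open>The increasing chain\<close>

lemma inc_le:
  assumes "c 0 < c k" and "[i = j] (mod k)" and "i \<le> j"
  shows "c i \<le> c j"
proof (cases "i = j")
  case False
  with assms(3) have "i < j" by simp
  from cong_le_obtain[OF assms(2) this] obtain s where "j = i + s * k" .
  then show ?thesis using inc_mono[OF assms(1)] by simp
qed simp

lemma c_a_le: "c a \<le> X b"
  using c_le(2)[of a] by (simp only: a_add)

lemma c_b_eq: "c b = inf (X b) (X (Suc n))"
  by (simp only: c_def b_add)

lemma a_le_b: "a \<le> b" and b_le_n: "b \<le> n" and b_pos: "0 < b"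
  using a_add b_add k_pos by linarith+

text \<open>If \<eta> missed \<open>c (M + k)\<close>, the meet of \<open>X (M + 2 * k)\<close> with
  \<open>(\<sigma> ^^ k) \<eta>\<close> would not be below \<eta>. PEC copies this to some
  \<open>m \<le> a\<close> and \<open>j\<close>, but there the meet is at most
  \<open>c m \<le> c b \<le> \<eta>\<close>.\<close>

lemma inc_chain_step:
  assumes inc: "c 0 < c k" and init: "initial_point p \<eta>"
    and le: "c b \<le> \<eta>" "c M \<le> \<eta>" and M: "[M = b] (mod k)" "b \<le> M"
  shows "c (M + k) \<le> \<eta>"
proof (rule ccontr)
  assume not_le: "\<not> c (M + k) \<le> \<eta>"
  have "n < M + 2 * k" using M(2) b_add k_pos by linarith
  moreover have "[M + 2 * k = Suc n] (mod k)"
    using cong_trans[OF M(1) b_cong] by (simp add: cong_def)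
  ultimately obtain m j where m: "[m = b] (mod k)" "m \<le> a" and j: "0 < j"
    and same: "same_triple \<eta> (X (M + 2 * k)) ((\<sigma> ^^ k) \<eta>) (X m) ((\<sigma> ^^ j) \<eta>)"
    using realize[OF init init _ _ k_pos] by blast
  have "c (M + k) \<le> (\<sigma> ^^ k) \<eta>" using le(2) shift_le[of k "c M" \<eta>] by (simp add: shift_c)
  moreover have "c (M + k) \<le> X (M + 2 * k)" using c_le(2)[of "M + k"] by (simp add: mult_2 add.assoc)
  ultimately have "c (M + k) \<le> inf (X (M + 2 * k)) ((\<sigma> ^^ k) \<eta>)" by simp
  then have "\<not> inf (X (M + 2 * k)) ((\<sigma> ^^ k) \<eta>) \<le> \<eta>" using not_le order.trans by blast
  then have not_le': "\<not> inf (X m) ((\<sigma> ^^ j) \<eta>) \<le> \<eta>" using same by (simp add: same_triple_def)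
  have "c (b + j) \<le> (\<sigma> ^^ j) \<eta>" using le(1) shift_le[of j "c b" \<eta>] by (simp add: shift_c)
  \<comment> \<open>\<open>X m\<close> leaves the chain before index \<open>b + j\<close>, so the
    meet with \<open>(\<sigma> ^^ j) \<eta>\<close> can be cut at \<open>c (b + j)\<close>, which
    need not be in the class of \<open>m\<close>.\<close>
  moreover have less: "m < b + j" using m(2) a_le_b j by linarith
  then have "\<not> c (b + j) \<le> X m" by (rule inc_not_le[OF inc])
  ultimately have "inf (X m) ((\<sigma> ^^ j) \<eta>) = inf (X m) (c (b + j))" by (rule inf_cut)
  also have "\<dots> \<le> inf (X m) (X (b + j))" using c_le(1)[of "b + j"] by (simp add: le_infI2)
  also have "\<dots> \<le> c m" by (rule inc_inf_le[OF inc]) (use less in simp)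
  also have "\<dots> \<le> c b" by (rule inc_le[OF inc m(1)]) (use m(2) a_le_b in simp)
  also note le(1)
  finally show False using not_le' by simp
qed

lemma inc_chain:
  assumes "c 0 < c k" and "initial_point p \<eta>" and "c b \<le> \<eta>"
  shows "c (b + s * k) \<le> \<eta>"
proof (induction s)
  case (Suc s)
  have "c (b + s * k + k) \<le> \<eta>"
    by (rule inc_chain_step[OF assms Suc]) (simp_all add: cong_def)
  then show ?case by (simp add: ac_simps)
qed (use assms in simp)

text \<open>Since \<open>c b\<close> is the meet of \<open>X (Suc n)\<close> and \<open>X b\<close>,
  its failing to lie below \<eta> is copied by PEC to \<open>X m\<close> and some
  \<open>X j\<close>. For \<open>j \<noteq> m\<close> their meet is at most
  \<open>c m \<le> c a\<close>; \<open>j = m\<close> would force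
  \<open>X (Suc n) \<le> X b\<close>.\<close>

lemma inc_known_imp:
  assumes inc: "c 0 < c k" and init: "initial_point p \<eta>" and le: "c a \<le> \<eta>"
  shows "c b \<le> \<eta>"
proof (rule ccontr)
  assume not_le: "\<not> c b \<le> \<eta>"
  obtain m j where m: "[m = b] (mod k)" "m \<le> a"
    and same: "same_triple \<eta> (X (Suc n)) (X b) (X m) (X j)"
    using realize[OF init start_initial lessI cong_refl b_pos] unfolding X_def by blast
  have "\<not> inf (X (Suc n)) (X b) \<le> \<eta>" using not_le by (simp add: c_b_eq inf.commute)
  then have not_le': "\<not> inf (X m) (X j) \<le> \<eta>" using same by (simp add: same_triple_def)
  show False
  proof (cases "j = m")
    case True
    then have "X (Suc n) \<le> X b" using same by (simp add: same_triple_def)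
    with c_le(1)[of "Suc n"] have "c (Suc n) \<le> X b" by (rule order.trans)
    moreover have "b < Suc n" using b_le_n by simp
    ultimately show False using inc_not_le[OF inc] by blast
  next
    case False
    have "[m = a] (mod k)" using cong_trans[OF m(1) cong_sym[OF a_cong]] .
    from inc_inf_le[OF inc False, of] inc_le[OF inc this m(2)] le
    have "inf (X m) (X j) \<le> \<eta>" by (meson order.trans)
    with not_le' show False ..
  qed
qed

text \<open>If \<eta> lies above \<open>c a\<close>, it lies above the chain from \<open>b\<close>
  on in its class, and so does \<open>(\<sigma> ^^ k) \<eta>\<close> from one step later;
  \<open>X (Suc n)\<close> leaves that chain earlier.\<close>

lemma inc_case:
  assumes inc: "c 0 < c k" and init: "initial_point p \<eta>"
  shows "c a \<le> X (Suc n)" and "c a \<le> \<eta> \<Longrightarrow> \<not> inf \<eta> ((\<sigma> ^^ k) \<eta>) \<le> X (Suc n)"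
proof -
  have "c a \<le> c b" by (rule inc_le[OF inc a_cong a_le_b])
  then show "c a \<le> X (Suc n)" by (simp add: c_b_eq)
  assume "c a \<le> \<eta>"
  then have b: "c b \<le> \<eta>" by (rule inc_known_imp[OF inc init])
  have "c (Suc n) \<le> \<eta>" using inc_chain[OF inc init b, of 1] by (simp add: b_add)
  then have "c (Suc n + k) \<le> (\<sigma> ^^ k) \<eta>"
    using shift_le[of k "c (Suc n)" \<eta>] by (simp only: shift_c)
  moreover have eq: "b + 2 * k = Suc n + k" unfolding b_add[symmetric] by simp
  have "c (Suc n + k) \<le> \<eta>" using inc_chain[OF inc init b, of 2] unfolding eq .
  moreover have "\<not> c (Suc n + k) \<le> X (Suc n)" by (rule inc_not_le[OF inc]) (use k_pos in simp)
  ultimately show "\<not> inf \<eta> ((\<sigma> ^^ k) \<eta>) \<le> X (Suc n)" by (meson le_infI order.trans)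
qed

section \<open>The decreasing chain\<close>

lemma dec_known:
  assumes dec: "c k < c 0" and "c a \<le> \<eta>"
  shows "\<not> inf \<eta> (X b) \<le> X (Suc n)"
proof
  assume "inf \<eta> (X b) \<le> X (Suc n)"
  moreover have "c a \<le> inf \<eta> (X b)" using assms(2) c_a_le by simp
  ultimately have "c a \<le> X (Suc n)" using order.trans by blast
  then have "c a \<le> c b" using c_a_le by (simp add: c_b_eq)
  moreover have "c b < c a" using dec_step[OF dec, of a] by (simp only: a_add)
  ultimately show False by simp
qed

text \<open>Two applications of PEC refute \<open>c b \<le> \<eta>\<close>. The first, to
  \<open>X (Suc n)\<close> and \<open>X b\<close>, shows that the meet of \<eta> with
  \<open>X (Suc n)\<close> is not below \<open>X b\<close>. The second, to
  \<open>X (Suc n + k)\<close> and \<open>(\<sigma> ^^ k) \<eta>\<close>, copies the shifted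
  relation to exponents at which it fails.\<close>

lemma dec_unknown:
  assumes dec: "c k < c 0" and init: "initial_point p \<eta>" and not_le: "\<not> c a \<le> \<eta>"
  shows "\<not> c b \<le> \<eta>"
proof
  assume le: "c b \<le> \<eta>"
  have c_m: "c b \<le> c m" if "[m = b] (mod k)" "m \<le> b" for m
    by (rule dec_le[OF dec that])
  have c_a: "c a \<le> X i" if "[i = b] (mod k)" "i \<le> b" for i
  proof (cases "i = b")
    case False
    then have "i + k \<le> b" using cong_less_add_le[OF that(1)] that(2) by simp
    then have "i \<le> a" using a_add by linarith
    then have "c a \<le> c i" by (rule dec_le[OF dec cong_trans[OF that(1) cong_sym[OF a_cong]]])
    then show ?thesis using c_le(1) order.trans by blast
  qed (simp add: c_a_le)
  \<comment> \<open>The common meet of \<eta> with all earlier points in the class of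
    \<open>b\<close>: they share \<open>c a\<close>, which is not below \<eta>.\<close>
  define f where "f = inf \<eta> (c a)"
  have f: "inf \<eta> (X i) = f" if "[i = b] (mod k)" "i \<le> b" for i
    unfolding f_def by (rule inf_cut[OF c_a[OF that] not_le])
  have "c b \<le> c a" by (rule c_m[OF a_cong a_le_b])
  then have c_b_f: "c b \<le> f" using le by (simp add: f_def)
  have noncong: "inf \<eta> (X j) \<le> c b" if "\<not> [j = b] (mod k)" for j
  proof -
    have "\<not> c b \<le> X j" by (rule noncong_not_le) (use that in \<open>simp add: cong_sym_eq\<close>)
    from inf_cut[OF le this] show ?thesis by (metis inf.commute inf.cobounded1)
  qed
  have j_le: "j \<le> b" if "(start, (\<sigma> ^^ j) start) \<in> p ^^ j" "[j = b] (mod k)" for j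
  proof -
    have "j < Suc n" using start_relpow[OF that(1)] by simp
    then have "j + k \<le> Suc n" by (rule cong_less_add_le[OF cong_trans[OF that(2) b_cong]])
    then show ?thesis using b_add by linarith
  qed
  obtain m j where m: "[m = b] (mod k)" "m \<le> a" and j: "(start, (\<sigma> ^^ j) start) \<in> p ^^ j"
    and same: "same_triple \<eta> (X (Suc n)) (X b) (X m) (X j)"
    using realize[OF init start_initial lessI cong_refl b_pos] unfolding X_def by blast
  have m_le: "m \<le> b" using m(2) a_le_b by simp
  have "inf \<eta> (X j) \<le> X m"
  proof (cases "[j = b] (mod k)")
    case True
    then have "inf \<eta> (X j) = inf \<eta> (X m)" using f[OF m(1) m_le] f[OF True j_le[OF j True]] by simp
    then show ?thesis by simp
  next
    case False
    from noncong[OF this] c_m[OF m(1) m_le] c_le(1)[of m] show ?thesis by (meson order.trans)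
  qed
  then have "inf \<eta> (X b) \<le> X (Suc n)" using same by (simp add: same_triple_def)
  then have "f \<le> X (Suc n)" using f[OF cong_refl order.refl] by simp
  moreover have "f \<le> X b" using f[OF cong_refl order.refl] by (metis inf.cobounded2)
  ultimately have "f \<le> c b" by (simp add: c_b_eq)
  with c_b_f have f_eq: "f = c b" by simp
  \<comment> \<open>Otherwise the copy would put \<open>X j\<close> in the class of
    \<open>b\<close>, and then \<open>c a\<close> would lie below the meet of \<open>X m\<close> and
    \<open>X j\<close>, hence below \<eta>.\<close>
  have inf_N: "\<not> inf \<eta> (X (Suc n)) \<le> X b"
  proof
    assume "inf \<eta> (X (Suc n)) \<le> X b"
    then have "inf \<eta> (X m) \<le> X j" using same by (simp add: same_triple_def)
    then have "c b \<le> X j" using f[OF m(1) m_le] f_eq by simp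
    then have "[b = j] (mod k)" using noncong_not_le by blast
    then have cong_j: "[j = b] (mod k)" by (rule cong_sym)
    have "inf (X (Suc n)) (X b) \<le> \<eta>" using le by (simp add: c_b_eq inf.commute)
    then have "inf (X m) (X j) \<le> \<eta>" using same by (simp add: same_triple_def)
    moreover have "c a \<le> inf (X m) (X j)"
      using c_a[OF m(1) m_le] c_a[OF cong_j j_le[OF j cong_j]] by simp
    ultimately show False using not_le order.trans by blast
  qed
  \<comment> \<open>Second application of PEC, one period later, with \<eta> itself as the third
    orbit.\<close>
  have "n < Suc n + k" by simp
  moreover have "[Suc n + k = Suc n] (mod k)" unfolding cong_def by (rule mod_add_self2)
  ultimately obtain m j where m: "[m = b] (mod k)" "m \<le> a" and j: "0 < j"
    and same: "same_triple \<eta> (X (Suc n + k)) ((\<sigma> ^^ k) \<eta>) (X m) ((\<sigma> ^^ j) \<eta>)"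
    using realize[OF init init _ _ k_pos] by blast
  have m_le: "m \<le> b" using m(2) a_le_b by simp
  \<comment> \<open>If it were below \<eta>, the meet would be comparable with \<open>c b\<close>.
    Being below contradicts the shift of \<open>inf_N\<close>; being above gives
    \<open>c b \<le> c (Suc n)\<close>, against strict decrease.\<close>
  have "\<not> inf (X (Suc n + k)) ((\<sigma> ^^ k) \<eta>) \<le> \<eta>"
  proof
    let ?h = "inf (X (Suc n + k)) ((\<sigma> ^^ k) \<eta>)"
    assume h: "?h \<le> \<eta>"
    have h_eq: "?h = (\<sigma> ^^ k) (inf \<eta> (X (Suc n)))"
      by (simp only: shift_inf shift_X inf.commute)
    have "\<not> ?h \<le> (\<sigma> ^^ k) (X b)" unfolding h_eq shift_le by (rule inf_N)
    then have not_N: "\<not> ?h \<le> X (Suc n)" by (simp only: shift_X b_add) simp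
    have c_b_N: "c b \<le> X (Suc n)" by (simp add: c_b_eq)
    from below_linear[OF h le] show False
    proof
      assume "?h \<le> c b"
      then show False using c_b_N not_N order.trans by blast
    next
      assume "c b \<le> ?h"
      then have "c b \<le> X (Suc n + k)" by simp
      then have "c b \<le> c (Suc n)" using c_b_N by (simp add: c_def[of "Suc n"])
      moreover have "c (Suc n) < c b" using dec_step[OF dec, of b] by (simp only: b_add)
      ultimately show False by simp
    qed
  qed
  then have not_le': "\<not> inf (X m) ((\<sigma> ^^ j) \<eta>) \<le> \<eta>" using same by (simp add: same_triple_def)
  \<comment> \<open>For \<open>k dvd j\<close> the meet is cut at \<open>c (a + j)\<close>, the
    shift of \<open>c a\<close>, which \<open>(\<sigma> ^^ j) \<eta>\<close> misses. Otherwise it is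
    cut at \<open>c (b + j)\<close>, which \<open>X m\<close> misses by incongruence.\<close>
  have "inf (X m) ((\<sigma> ^^ j) \<eta>) \<le> c b"
  proof (cases "k dvd j")
    case True
    let ?g = "c (a + j)"
    have "k \<le> j" using True j by (rule dvd_imp_le)
    then have ge: "b \<le> a + j" using a_add by linarith
    have cong: "[b = a + j] (mod k)"
      using True a_cong by (auto simp: cong_def dvd_def)
    have g_b: "?g \<le> c b" by (rule dec_le[OF dec cong ge])
    have "\<not> ?g \<le> (\<sigma> ^^ j) \<eta>" using not_le shift_le[of j "c a" \<eta>] by (simp add: shift_c)
    moreover have "?g \<le> X m" using g_b c_m[OF m(1) m_le] c_le(1)[of m] by (meson order.trans)
    ultimately have "inf ((\<sigma> ^^ j) \<eta>) (X m) = inf ((\<sigma> ^^ j) \<eta>) ?g" using inf_cut by blast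
    then show ?thesis using g_b by (metis inf.commute le_infI2)
  next
    case False
    have nc: "\<not> [m = b + j] (mod k)"
    proof
      assume "[m = b + j] (mod k)"
      with m(1) have "[b + j = b + 0] (mod k)" using cong_sym cong_trans by (metis add.right_neutral)
      then show False using False by (simp only: cong_add_lcancel_nat cong_0_iff)
    qed
    have "c (b + j) \<le> (\<sigma> ^^ j) \<eta>" using le shift_le[of j "c b" \<eta>] by (simp add: shift_c)
    moreover have "\<not> c (b + j) \<le> X m" by (rule noncong_not_le) (use nc in \<open>simp add: cong_sym_eq\<close>)
    ultimately have "inf (X m) ((\<sigma> ^^ j) \<eta>) = inf (X m) (c (b + j))" by (rule inf_cut)
    also have "\<dots> \<le> inf (X m) (X (b + j))" using c_le(1)[of "b + j"] by (simp add: le_infI2)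
    also have "\<dots> < c b" by (rule noncong_less[OF nc cong_sym[OF m(1)] m_le])
    finally show ?thesis by simp
  qed
  then show False using not_le' le order.trans by blast
qed

end

section \<open>Uniqueness of the type of the next point\<close>

text \<open>Each point of \<open>S\<close> either leaves \<open>v\<close> and \<open>w\<close> at
  the same place or can be traded for a point of \<open>R\<close>, over which \<open>v\<close> and
  \<open>w\<close> agree.\<close>

lemma (in universal_tree) same_type_over:
  fixes S R :: "'a set" and v w :: 'a
  assumes "finite S"
    and R: "\<And>r. r \<in> R \<Longrightarrow> v \<le> r \<longleftrightarrow> w \<le> r"
      "\<And>r s. r \<in> R \<Longrightarrow> s \<in> R \<Longrightarrow> inf v r \<le> s \<longleftrightarrow> inf w r \<le> s"
      "\<And>r s. r \<in> R \<Longrightarrow> s \<in> R \<Longrightarrow> inf r s \<le> v \<longleftrightarrow> inf r s \<le> w"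
    and S: "\<And>a. a \<in> S \<Longrightarrow> a \<in> R \<or> (\<exists>g. g \<le> v \<and> g \<le> w \<and> \<not> g \<le> a) \<or>
      (\<exists>r\<in>R. \<not> inf a r \<le> v \<and> \<not> inf a r \<le> w)"
  shows "\<exists>f. automorphism f \<and> (\<forall>x\<in>S. f x = x) \<and> f v = w"
proof -
  define far where "far a \<longleftrightarrow> (\<exists>g. g \<le> v \<and> g \<le> w \<and> \<not> g \<le> a)" for a
  \<comment> \<open>\<open>r\<close> stands in for \<open>a\<close> in every atomic relation with
    \<open>v\<close> or \<open>w\<close>.\<close>
  define repl where "repl a r \<longleftrightarrow> r \<in> R \<and> (\<forall>u\<in>{v, w}.
      (u \<le> a \<longleftrightarrow> u \<le> r) \<and> inf u a = inf u r \<and> (\<forall>y. inf a y \<le> u \<longleftrightarrow> inf r y \<le> u))" for a r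
  have far_inf: "inf a v = inf a w" if "far a" for a
  proof -
    from that obtain g where "g \<le> v" "g \<le> w" "\<not> g \<le> a" unfolding far_def by blast
    then show ?thesis using inf_cut[of g v a] inf_cut[of g w a] by simp
  qed
  have far_le: "\<not> v \<le> a" "\<not> w \<le> a" if "far a" for a
  proof -
    from that obtain g where "g \<le> v" "g \<le> w" "\<not> g \<le> a" unfolding far_def by blast
    then show "\<not> v \<le> a" "\<not> w \<le> a" using order.trans[of g _ a] by auto
  qed
  \<comment> \<open>Seen from \<open>u\<close>, and likewise from any \<open>y\<close> not above it,
    \<open>a\<close> and \<open>r\<close> can both be cut at \<open>inf a r\<close>. If
    \<open>y\<close> is above \<open>inf a r\<close>, neither meet with \<open>y\<close> is below
    \<open>u\<close>.\<close>
  have replI: "(u \<le> a \<longleftrightarrow> u \<le> r) \<and> inf u a = inf u r \<and> (\<forall>y. inf a y \<le> u \<longleftrightarrow> inf r y \<le> u)"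
    if "\<not> inf a r \<le> u" for a r u :: 'a
  proof -
    let ?g = "inf a r"
    have "inf u a = inf u ?g" "inf u r = inf u ?g"
      by (rule inf_cut[OF _ that], simp)+
    then have eq: "inf u a = inf u r" by (rule trans[OF _ sym])
    have le: "u \<le> a \<longleftrightarrow> u \<le> r" by (simp only: le_iff_inf eq)
    have "inf a y \<le> u \<longleftrightarrow> inf r y \<le> u" for y
    proof (cases "?g \<le> y")
      case True
      have "\<not> inf a y \<le> u"
      proof
        assume "inf a y \<le> u"
        moreover have "?g \<le> inf a y" using True by simp
        ultimately show False using that order.trans by blast
      qed
      moreover have "\<not> inf r y \<le> u"
      proof
        assume "inf r y \<le> u"
        moreover have "?g \<le> inf r y" using True by simp
        ultimately show False using that order.trans by blast
      qed
      ultimately show ?thesis by simp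
    next
      case False
      have "inf y a = inf y ?g" "inf y r = inf y ?g"
        by (rule inf_cut[OF _ False], simp)+
      then have "inf y a = inf y r" by (rule trans[OF _ sym])
      then show ?thesis by (simp add: inf.commute)
    qed
    with eq le show ?thesis by simp
  qed
  have cover: "far a \<or> (\<exists>r. repl a r)" if "a \<in> S" for a
    using S[OF that]
  proof (elim disjE)
    assume "a \<in> R"
    then have "repl a a" by (simp add: repl_def)
    then show ?thesis by blast
  next
    assume "\<exists>r\<in>R. \<not> inf a r \<le> v \<and> \<not> inf a r \<le> w"
    then obtain r where r: "r \<in> R" "\<not> inf a r \<le> v" "\<not> inf a r \<le> w" by blast
    have "repl a r"
      unfolding repl_def
    proof (intro conjI[OF r(1)] ballI)
      fix u assume "u \<in> {v, w}"
      then have "\<not> inf a r \<le> u" using r(2,3) by auto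
      then show "(u \<le> a \<longleftrightarrow> u \<le> r) \<and> inf u a = inf u r \<and> (\<forall>y. inf a y \<le> u \<longleftrightarrow> inf r y \<le> u)"
        by (rule replI)
    qed
    then show ?thesis by blast
  qed (simp add: far_def)
  show ?thesis
  proof (rule extend_point[OF assms(1)])
    fix x assume "x \<in> S"
    then show "v \<le> x \<longleftrightarrow> w \<le> x"
      using cover[of x] far_le[of x] R(1) by (auto simp: repl_def)
  next
    fix x y assume xy: "x \<in> S" "y \<in> S"
    show "inf v x \<le> y \<longleftrightarrow> inf w x \<le> y"
    proof (cases "far x")
      case True
      then show ?thesis using far_inf[of x] by (simp add: inf.commute)
    next
      case not_far: False
      show ?thesis
      proof (cases "far y")
        case True
        then obtain g where g: "g \<le> v" "g \<le> w" "\<not> g \<le> y" unfolding far_def by blast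
        show ?thesis
        proof (cases "g \<le> x")
          case True
          then have "g \<le> inf v x" "g \<le> inf w x" using g by simp_all
          then show ?thesis using g(3) order.trans by blast
        next
          case False
          from inf_cut[OF g(1) this] inf_cut[OF g(2) this] show ?thesis by (simp add: inf.commute)
        qed
      next
        case False
        with not_far obtain r s where "repl x r" "repl y s" using cover xy by blast
        then have rs: "r \<in> R" "s \<in> R" "inf v x = inf v r" "inf w x = inf w r" "inf v y = inf v s" "inf w y = inf w s"
          by (simp_all add: repl_def)
        have "inf v x \<le> y \<longleftrightarrow> inf v r \<le> inf v s" unfolding rs(3,5)[symmetric] by simp
        moreover have "inf w x \<le> y \<longleftrightarrow> inf w r \<le> inf w s" unfolding rs(4,6)[symmetric] by simp
        moreover have "inf v r \<le> inf v s \<longleftrightarrow> inf w r \<le> inf w s" using R(2)[OF rs(1,2)] by simp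
        ultimately show ?thesis by simp
      qed
    qed
    have far_case: "inf x y \<le> v \<longleftrightarrow> inf x y \<le> w" if "far x" for x y
    proof -
      have "inf x y \<le> v \<longleftrightarrow> inf x y \<le> inf x v" by simp
      also have "\<dots> \<longleftrightarrow> inf x y \<le> w" unfolding far_inf[OF that] by simp
      finally show ?thesis .
    qed
    show "inf x y \<le> v \<longleftrightarrow> inf x y \<le> w"
    proof (cases "far x \<or> far y")
      case True
      then show ?thesis using far_case[of x y] far_case[of y x] by (auto simp: inf.commute)
    next
      case False
      then obtain r s where "repl x r" "repl y s" using cover xy by blast
      then have eq: "inf x y \<le> u \<longleftrightarrow> inf r s \<le> u" if "u \<in> {v, w}" for u
      proof -
        have "inf x y \<le> u \<longleftrightarrow> inf y r \<le> u"
          using bspec[OF conjunct2[OF \<open>repl x r\<close>[unfolded repl_def]] that, THEN conjunct2, THEN conjunct2,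
              THEN spec, of y] by (simp add: inf.commute)
        also have "\<dots> \<longleftrightarrow> inf r s \<le> u"
          using bspec[OF conjunct2[OF \<open>repl y s\<close>[unfolded repl_def]] that, THEN conjunct2, THEN conjunct2,
              THEN spec, of r] by (simp add: inf.commute)
        finally show ?thesis .
      qed
      have "r \<in> R" "s \<in> R" using \<open>repl x r\<close> \<open>repl y s\<close> by (simp_all add: repl_def)
      then show ?thesis using eq[of v] eq[of w] R(3) by simp
    qed
  qed
qed

section \<open>Comparing two extensions of the orbit\<close>

context pec_orbit
begin

text \<open>A point outside the range can only be the first of its orbit, and that orbit is not
  cyclic. Being no shorter than \<xi>, which has \<open>Suc n\<close> distinct points, it provides
  \<open>n\<close> iterates under \<open>p\<close>.\<close>

lemma orbit_point:
  assumes ext: "extends \<sigma> p" and \<eta>: "orbit_of p \<eta>" "x \<in> set \<eta>"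
    and shortest: "\<not> cyclic \<eta> \<Longrightarrow> orbit_length \<xi> \<le> orbit_length \<eta>"
    and notin: "x \<notin> Range p"
  shows "initial_point p x" and "\<And>i. i \<le> n \<Longrightarrow> (x, (\<sigma> ^^ i) x) \<in> p ^^ i"
proof -
  from \<eta>(2) obtain i where i: "i < length \<eta>" "x = \<eta> ! i" by (auto simp: in_set_conv_nth)
  have step: "(\<eta> ! i, \<eta> ! Suc i) \<in> p" if "Suc i < length \<eta>" for i
    using \<eta>(1) that by (simp add: orbit_of_def)
  have in_Range: "\<eta> ! i \<in> Range p" if "0 < i" "i < length \<eta>" for i
    using step[of "i - 1"] that by (intro RangeI) simp
  have x: "x = \<eta> ! 0" using in_Range[of i] i notin by (cases i) auto
  have "2 \<le> length \<eta>" using \<eta>(1) by (simp add: orbit_of_def)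
  then have "(x, \<eta> ! 1) \<in> p" using step[of 0] x by simp
  then show "initial_point p x" using notin by (auto simp: initial_point_def)
  have noncyc: "\<not> cyclic \<eta>"
  proof
    assume "cyclic \<eta>"
    then obtain l where "0 < l" "l < length \<eta>" "\<eta> ! 0 = \<eta> ! l" unfolding cyclic_def by blast
    then show False using in_Range[of l] x notin by simp
  qed
  have inj: "\<xi> ! i \<noteq> \<xi> ! j" if "i < j" "j \<le> n" for i j
  proof
    assume "\<xi> ! i = \<xi> ! j"
    then have "(\<sigma> ^^ i) start = (\<sigma> ^^ i) ((\<sigma> ^^ (j - i)) start)"
      using that extends_nth[OF ext, of i] extends_nth[OF ext, of j] by (simp add: funpow_add_apply)
    then have "(\<sigma> ^^ (j - i)) start = start"
      by (simp only: automorphism_inj[OF automorphism_funpow[OF extends_automorphism[OF ext]]])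
    then show False using extends_not_periodic[OF ext, of "j - i"] that by simp
  qed
  have "distinct \<xi>"
    unfolding distinct_conv_nth
  proof (intro allI impI)
    fix i j assume "i < length \<xi>" "j < length \<xi>" "i \<noteq> j"
    then show "\<xi> ! i \<noteq> \<xi> ! j"
      using inj[of i j] inj[of j i] by (cases i j rule: linorder_cases) (simp_all add: length_orbit)
  qed
  then have "Suc n = orbit_length \<xi>" by (simp add: orbit_length_def distinct_card length_orbit)
  also have "\<dots> \<le> orbit_length \<eta>" by (rule shortest[OF noncyc])
  also have "\<dots> \<le> length \<eta>" unfolding orbit_length_def by (rule card_length)
  finally have len: "Suc n \<le> length \<eta>" .
  have rel: "(x, \<eta> ! i) \<in> p ^^ i" if "i \<le> n" for i
    using that
  proof (induction i)
    case (Suc i)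
    then have "(x, \<eta> ! i) \<in> p ^^ i" "(\<eta> ! i, \<eta> ! Suc i) \<in> p" using step len by simp_all
    then show ?case by (rule relpow_Suc_I)
  qed (simp add: x)
  show "(x, (\<sigma> ^^ i) x) \<in> p ^^ i" if "i \<le> n" for i
    using rel[OF that] extends_relpow[OF ext rel[OF that]] by simp
qed

text \<open>The two alternatives are those of \<open>same_type_over\<close> for a point outside the
  range. Both extensions share \<open>k\<close>, the direction of the chain and \<open>c a\<close>,
  so the same case applies to \<open>v\<close> and \<open>w\<close>.\<close>

lemma next_point_dichotomy:
  assumes \<sigma>: "extends \<sigma> p" and \<tau>: "extends \<tau> p" and init: "initial_point p x"
    and rel: "\<And>\<rho> i. extends \<rho> p \<Longrightarrow> i \<le> n \<Longrightarrow> (x, (\<rho> ^^ i) x) \<in> p ^^ i"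
  defines "v \<equiv> (\<sigma> ^^ Suc n) start" and "w \<equiv> (\<tau> ^^ Suc n) start"
  shows "(\<exists>g. g \<le> v \<and> g \<le> w \<and> \<not> g \<le> x) \<or> (\<exists>r\<in>Range p. \<not> inf x r \<le> v \<and> \<not> inf x r \<le> w)"
proof -
  interpret V: pec_extension T p \<xi> \<sigma> by unfold_locales (rule \<sigma>)
  interpret W: pec_extension T p \<xi> \<tau> by unfold_locales (rule \<tau>)
  have "moves_meet \<tau> start V.k" "moves_meet \<sigma> start W.k"
    using moves_meet_visible[OF \<sigma> \<tau>] V.moves_meet_k V.two_k_le W.moves_meet_k W.two_k_le by blast+
  then have k: "W.k = V.k"
    unfolding V.k_def W.k_def by (meson Least_le order.antisym)
  have a: "W.a = V.a" and b: "W.b = V.b" by (simp_all add: W.a_def V.a_def W.b_def V.b_def k)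
  have X: "W.X i = V.X i" if "i \<le> n" for i
    using that extends_nth[OF \<sigma>] extends_nth[OF \<tau>] by (simp add: W.X_def V.X_def)
  have c: "W.c i = V.c i" if "i + V.k \<le> n" for i
  proof -
    have "W.X (i + W.k) = V.X (i + V.k)" "W.X i = V.X i" using X that by (simp_all add: k)
    then show ?thesis by (simp only: W.c_def V.c_def)
  qed
  have c_a: "W.c V.a = V.c V.a" by (rule c) (simp add: V.a_add V.b_le_n)
  have c_0: "W.c 0 = V.c 0" "W.c V.k = V.c V.k"
    by (rule c, use V.two_k_le in simp)+
  have vw: "v = V.X (Suc n)" "w = W.X (Suc n)" by (simp_all add: v_def w_def V.X_def W.X_def)
  have X_b: "V.X V.b \<in> Range p" "W.X V.b = V.X V.b"
    using extends_nth_Range[OF \<sigma> V.b_pos V.b_le_n] X[OF V.b_le_n] by (simp_all add: V.X_def)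
  show ?thesis
    using V.inc_or_dec
  proof
    assume inc: "V.c 0 < V.c V.k"
    then have inc': "W.c 0 < W.c W.k" using c_0 by (simp add: k)
    show ?thesis
    proof (cases "V.c V.a \<le> x")
      case True
      have k_le: "V.k \<le> n" using V.two_k_le by simp
      have eq: "(\<tau> ^^ V.k) x = (\<sigma> ^^ V.k) x"
        using extends_relpow[OF \<tau> rel[OF \<sigma> k_le]] .
      have "\<not> inf x ((\<sigma> ^^ V.k) x) \<le> v"
        unfolding vw by (rule V.inc_case(2)[OF inc init True])
      moreover have "\<not> inf x ((\<sigma> ^^ V.k) x) \<le> w"
        using W.inc_case(2)[OF inc' init, unfolded a c_a, OF True] unfolding vw k eq .
      moreover have "(\<sigma> ^^ V.k) x \<in> Range p"
      proof -
        obtain s where s: "V.k = Suc s" using V.k_pos gr0_implies_Suc by blast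
        have "(x, (\<sigma> ^^ V.k) x) \<in> p ^^ Suc s" using rel[OF \<sigma> k_le] s by simp
        then obtain z where "(z, (\<sigma> ^^ V.k) x) \<in> p" by (rule relpow_Suc_E)
        then show ?thesis by (rule RangeI)
      qed
      ultimately show ?thesis by blast
    next
      case False
      then show ?thesis using V.inc_case(1)[OF inc init] W.inc_case(1)[OF inc' init] by (auto simp: a c_a vw)
    qed
  next
    assume dec: "V.c V.k < V.c 0"
    then have dec': "W.c W.k < W.c 0" using c_0 by (simp add: k)
    show ?thesis
    proof (cases "V.c V.a \<le> x")
      case True
      then have "\<not> inf x (V.X V.b) \<le> v" "\<not> inf x (V.X V.b) \<le> w"
        using V.dec_known[OF dec, of x] W.dec_known[OF dec', of x] X_b by (simp_all add: a b c_a vw)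
      then show ?thesis using X_b(1) by blast
    next
      case False
      then have not_le: "\<not> V.c V.b \<le> x" "\<not> W.c V.b \<le> x"
        using V.dec_unknown[OF dec init] W.dec_unknown[OF dec' init] by (simp_all add: a b c_a)
      have c_b: "V.c V.b = inf (V.X V.b) v" "W.c V.b = inf (V.X V.b) w"
        using V.c_b_eq W.c_b_eq X_b(2) by (simp_all add: b vw)
      \<comment> \<open>Both meets lie below the common point \<open>X b\<close>; the smaller one is
        below \<open>v\<close> and \<open>w\<close> but not below \<open>x\<close>.\<close>
      have "V.c V.b \<le> W.c V.b \<or> W.c V.b \<le> V.c V.b"
        unfolding c_b by (rule below_linear[OF inf.cobounded1 inf.cobounded1])
      then obtain g where "g \<le> V.c V.b" "g \<le> W.c V.b" "\<not> g \<le> x" using not_le by blast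
      then show ?thesis unfolding c_b by auto
    qed
  qed
qed

end

text \<open>The list may run on past its first return. Single-valuedness makes it periodic, so its
  last entry equals the one \<open>k\<close> places earlier, which has a successor.\<close>

lemma cyclic_orbit_last:
  assumes "single_valued p" and "orbit_of p \<xi>" and "cyclic \<xi>"
  shows "last \<xi> \<in> Domain p"
proof -
  obtain k where k: "0 < k" "k < length \<xi>" "\<xi> ! 0 = \<xi> ! k" using assms(3) unfolding cyclic_def by blast
  have step: "(\<xi> ! i, \<xi> ! Suc i) \<in> p" if "Suc i < length \<xi>" for i
    using assms(2) that by (simp add: orbit_of_def)
  have per: "\<xi> ! i = \<xi> ! (i + k)" if "i + k < length \<xi>" for i
    using that
  proof (induction i)
    case (Suc i)
    then have eq: "\<xi> ! i = \<xi> ! (i + k)" by simp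
    have "(\<xi> ! (i + k), \<xi> ! Suc i) \<in> p" "(\<xi> ! (i + k), \<xi> ! (Suc i + k)) \<in> p"
      using step[of i] step[of "i + k"] Suc.prems eq by simp_all
    then show ?case by (rule single_valuedD[OF assms(1)])
  qed (simp add: k)
  define i where "i = length \<xi> - 1 - k"
  have i: "i + k = length \<xi> - 1" "i + k < length \<xi>" "Suc i < length \<xi>"
    using k by (simp_all add: i_def)
  have "last \<xi> = \<xi> ! (i + k)" unfolding i(1) by (rule last_conv_nth) (use k in auto)
  also have "\<dots> = \<xi> ! i" using per[OF i(2)] ..
  finally show ?thesis using step[OF i(3)] by (simp add: DomainI)
qed

text \<open>The fixed points of an automorphism are closed under meets.\<close>

lemma automorphism_fixes_generated:
  assumes "automorphism f" and "\<forall>x\<in>S. f x = x"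
  shows "\<forall>x\<in>generated_meet_tree S. f x = x"
proof -
  have "generated_meet_tree S \<subseteq> {x. f x = x}"
    unfolding generated_meet_tree_def
    by (rule hull_minimal) (use assms in \<open>auto simp: automorphism_inf\<close>)
  then show ?thesis by blast
qed

theorem theorem6p8:
  fixes p :: "('a::semilattice_inf \<times> 'a) set"
    and \<xi> :: "'a list"
    and v w :: 'a
    and A :: "'a set"
  assumes "universal_meet_tree TYPE('a)"
    and "finite p"
    and "partial_automorphism p"
    and "PEC p"
    and "A = generated_meet_tree (\<Union>{set \<eta> | \<eta>. orbit_of p \<eta>})"
    and "orbit_of p \<xi>"
    and "\<forall>\<eta>. orbit_of p \<eta> \<and> \<not> cyclic \<eta> \<longrightarrow> \<not> orbit_length \<eta> < orbit_length \<xi>"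
    and "partial_automorphism (p \<union> {(last \<xi>, v)})"
    and "partial_automorphism (p \<union> {(last \<xi>, w)})"
  shows "tp [v] A = tp [w] A"
proof (cases "cyclic \<xi>")
  case True
  \<comment> \<open>In a cyclic orbit the last point already has an image under \<open>p\<close>, so
    \<open>v\<close> and \<open>w\<close> coincide.\<close>
  have sv: "single_valued p" using assms(3) by (simp add: partial_automorphism_def)
  obtain y where y: "(last \<xi>, y) \<in> p" using cyclic_orbit_last[OF sv assms(6) True] by blast
  have "u = y" if "partial_automorphism (p \<union> {(last \<xi>, u)})" for u
  proof -
    have "single_valued (p \<union> {(last \<xi>, u)})" using that by (simp add: partial_automorphism_def)
    then show ?thesis by (rule single_valuedD[of _ "last \<xi>"]) (use y in simp_all)
  qed
  then show ?thesis using assms(8,9) by metis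
next
  case False
  interpret pec_orbit "TYPE('a)" p \<xi>
    by unfold_locales (use assms False in simp_all)
  let ?S = "\<Union>{set \<eta> | \<eta>. orbit_of p \<eta>}"
  have last: "last \<xi> = \<xi> ! n"
    using length_orbit last_conv_nth[of \<xi>] by fastforce
  have extension: "\<exists>\<sigma>. extends \<sigma> p \<and> (\<sigma> ^^ Suc n) start = u"
    if "partial_automorphism (p \<union> {(last \<xi>, u)})" for u
  proof -
    have "finite (p \<union> {(last \<xi>, u)})" using finite_p by simp
    from extend_to_automorphism[OF this partial_automorphism_preserves_triples[OF that]]
    obtain \<sigma> where \<sigma>: "automorphism \<sigma>" "\<forall>(x, y)\<in>p \<union> {(last \<xi>, u)}. \<sigma> x = y" by blast
    then have ext: "extends \<sigma> p" by (auto simp: extends_def)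
    moreover have "(\<sigma> ^^ Suc n) start = u"
      using extends_nth[OF ext order.refl] \<sigma>(2) by (simp add: last)
    ultimately show ?thesis by blast
  qed
  obtain \<sigma> where \<sigma>: "extends \<sigma> p" "(\<sigma> ^^ Suc n) start = v" using extension[OF assms(8)] by blast
  obtain \<tau> where \<tau>: "extends \<tau> p" "(\<tau> ^^ Suc n) start = w" using extension[OF assms(9)] by blast
  have "?S \<subseteq> Field p"
  proof
    fix x assume "x \<in> ?S"
    then obtain \<eta> where \<eta>: "orbit_of p \<eta>" "x \<in> set \<eta>" by blast
    show "x \<in> Field p"
    proof (cases "x \<in> Range p")
      case False
      have "initial_point p x"
        by (rule orbit_point(1)[OF \<sigma>(1) \<eta> _ False]) (use assms(7) \<eta>(1) in \<open>simp add: not_less\<close>)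
      then show ?thesis by (simp add: initial_point_def Field_def)
    qed (simp add: Field_def)
  qed
  then have finS: "finite ?S" using finite_Field[OF finite_p] finite_subset by blast
  have "\<exists>f. automorphism f \<and> (\<forall>x\<in>?S. f x = x) \<and> f v = w"
  proof (rule same_type_over[OF finS, of "Range p"])
    \<comment> \<open>Over the range of \<open>p\<close>, every relation with \<open>v\<close> or
      \<open>w\<close> pulls back to the same relation between the last point of \<xi> and the
      domain.\<close>
    note triples_v = preserves_triplesD[OF partial_automorphism_preserves_triples[OF assms(8)]]
    note triples_w = preserves_triplesD[OF partial_automorphism_preserves_triples[OF assms(9)]]
    fix r assume "r \<in> Range p"
    then obtain r0 where r: "(r0, r) \<in> p" by blast
    show "v \<le> r \<longleftrightarrow> w \<le> r"
      using triples_v[of "last \<xi>" v "last \<xi>" v r0 r] triples_w[of "last \<xi>" w "last \<xi>" w r0 r] r by simp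
    fix s assume "s \<in> Range p"
    then obtain s0 where s: "(s0, s) \<in> p" by blast
    show "inf v r \<le> s \<longleftrightarrow> inf w r \<le> s"
      using triples_v[of "last \<xi>" v r0 r s0 s] triples_w[of "last \<xi>" w r0 r s0 s] r s by simp
    show "inf r s \<le> v \<longleftrightarrow> inf r s \<le> w"
      using triples_v[of r0 r s0 s "last \<xi>" v] triples_w[of r0 r s0 s "last \<xi>" w] r s by simp
  next
    fix x assume "x \<in> ?S"
    then obtain \<eta> where \<eta>: "orbit_of p \<eta>" "x \<in> set \<eta>" by blast
    have shortest: "\<not> cyclic \<eta> \<Longrightarrow> orbit_length \<xi> \<le> orbit_length \<eta>"
      using assms(7) \<eta>(1) by (simp add: not_less)
    show "x \<in> Range p \<or> (\<exists>g. g \<le> v \<and> g \<le> w \<and> \<not> g \<le> x) \<or>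
        (\<exists>r\<in>Range p. \<not> inf x r \<le> v \<and> \<not> inf x r \<le> w)"
    proof (cases "x \<in> Range p")
      case False
      note point = orbit_point[OF _ \<eta> shortest False]
      from next_point_dichotomy[OF \<sigma>(1) \<tau>(1) point(1)[OF \<sigma>(1)] point(2)]
      show ?thesis unfolding \<sigma>(2) \<tau>(2) by blast
    qed simp
  qed
  then obtain f where f: "automorphism f" "\<forall>x\<in>?S. f x = x" "f v = w" by blast
  have "tp (map f [v]) A = tp [v] A"
    by (rule tp_automorphism[OF f(1)]) (use automorphism_fixes_generated[OF f(1,2)] assms(5) in simp)
  then show ?thesis using f(3) by simp
qed

end
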